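(* Let $p\ge1$, $m=2p$. Consider two systems $W_{k+1}(\lambda)-W_k(\lambda)=-\frac{i}{\lambda}j\widetilde C_kW_k(\lambda)$, $0\le k\le\widetilde N$, and $W_{k+1}(\lambda)-W_k(\lambda)=-\frac{i}{\lambda}j\widehat C_kW_k(\lambda)$, $0\le k\le\widehat N$, where $\widetilde C_k=2K^*\widetilde\beta(k)^*\widetilde\beta(k)K-j$, $\widehat C_k=2K^*\widehat\beta(k)^*\widehat\beta(k)K-j$ with $p\times m$ matrices satisfying $\widetilde\beta(k)J\widetilde\beta(k)^*=I_p$, $\widehat\beta(k)J\widehat\beta(k)^*=I_p$. Let $\widetilde\varphi$ be a Weyl function of the first system on $0\le k\le\widetilde N$ and $\widehat\varphi$ a Weyl function of the second system on $0\le k\le\widehat N$, and let $\{\widetilde\alpha_k\}$, $\{\widehat\alpha_k\}$ be the Taylor coefficients at $z=0$ of $i\widetilde\varphi\big(i\frac{z+1}{z-1}\big)$ and $i\widehat\varphi\big(i\frac{z+1}{z-1}\big)$. If $\widetilde\alpha_k=\widehat\alpha_k$ for all $k\le N$, where $N\le\min\{\widetilde N,\widehat N\}$, then $\widetilde C_k=\widehat C_k$ for all $k\le N$.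
   Context: $\mathbb C_-$ is the open lower half-plane; $j=\mathrm{diag}(I_p,-I_p)$, $J=\begin{bmatrix}0&I_p\\ I_p&0\end{bmatrix}$, $K=\frac1{\sqrt2}\begin{bmatrix}I_p&-I_p\\ I_p&I_p\end{bmatrix}$. For a system $W_{k+1}=W_k-\frac i\lambda jC_kW_k$ on $0\le k\le L$ with $W_0=I_m$, put $\mathcal W(\lambda)=\{\mathcal W_{ij}(\lambda)\}_{i,j=1}^2=KW_{L+1}(\bar\lambda)^*$ ($p\times p$ blocks). A Weyl function of the system on $0\le k\le L$ is a $p\times p$ matrix function $\varphi$ holomorphic in $\mathbb C_-$ of the form $\varphi=i(\mathcal W_{21}R+\mathcal W_{22}Q)(\mathcal W_{11}R+\mathcal W_{12}Q)^{-1}$, where $R,Q$ are $p\times p$ matrix functions meromorphic in $\mathbb C_-$, well defined at $\lambda=-i$, with $R^*R+Q^*Q>0$ and $R^*R\le Q^*Q$. *)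

theory Defs
  imports "HOL-Complex_Analysis.Complex_Analysis" "Jordan_Normal_Form.Matrix"
begin

definition lower_half :: "complex set" where
  "lower_half = {z. Im z < 0}"

definition adj :: "complex mat \<Rightarrow> complex mat" where
  "adj A = mat (dim_col A) (dim_row A) (\<lambda>(i, j). cnj (A $$ (j, i)))"

definition jmat :: "nat \<Rightarrow> complex mat" where
  "jmat p = four_block_mat (1\<^sub>m p) (0\<^sub>m p p) (0\<^sub>m p p) (- 1\<^sub>m p)"

definition Jmat :: "nat \<Rightarrow> complex mat" where
  "Jmat p = four_block_mat (0\<^sub>m p p) (1\<^sub>m p) (1\<^sub>m p) (0\<^sub>m p p)"

definition Kmat :: "nat \<Rightarrow> complex mat" where
  "Kmat p = (complex_of_real (1 / sqrt 2)) \<cdot>\<^sub>m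
     four_block_mat (1\<^sub>m p) (- 1\<^sub>m p) (1\<^sub>m p) (1\<^sub>m p)"

definition Cof :: "nat \<Rightarrow> (nat \<Rightarrow> complex mat) \<Rightarrow> nat \<Rightarrow> complex mat" where
  "Cof p \<beta> k = 2 \<cdot>\<^sub>m (adj (Kmat p) * adj (\<beta> k) * \<beta> k * Kmat p) - jmat p"

fun Wsol :: "nat \<Rightarrow> (nat \<Rightarrow> complex mat) \<Rightarrow> complex \<Rightarrow> nat \<Rightarrow> complex mat" where
  "Wsol p C l 0 = 1\<^sub>m (2 * p)"
| "Wsol p C l (Suc k) = Wsol p C l k - (\<i> / l) \<cdot>\<^sub>m (jmat p * C k * Wsol p C l k)"

definition calW :: "nat \<Rightarrow> (nat \<Rightarrow> complex mat) \<Rightarrow> nat \<Rightarrow> complex \<Rightarrow> complex mat" where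
  "calW p C L l = Kmat p * adj (Wsol p C (cnj l) (Suc L))"

definition blk :: "nat \<Rightarrow> nat \<Rightarrow> nat \<Rightarrow> complex mat \<Rightarrow> complex mat" where
  "blk p r c M = mat p p (\<lambda>(a, b). M $$ (r * p + a, c * p + b))"

definition qform :: "nat \<Rightarrow> complex mat \<Rightarrow> (nat \<Rightarrow> complex) \<Rightarrow> complex" where
  "qform n A v = (\<Sum>a<n. \<Sum>b<n. cnj (v a) * A $$ (a, b) * v b)"

definition hermitian_mat :: "nat \<Rightarrow> complex mat \<Rightarrow> bool" where
  "hermitian_mat n A \<longleftrightarrow> A \<in> carrier_mat n n \<and> adj A = A"

definition posdef_mat :: "nat \<Rightarrow> complex mat \<Rightarrow> bool" where
  "posdef_mat n A \<longleftrightarrow> hermitian_mat n A \<and>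
     (\<forall>v. (\<exists>a<n. v a \<noteq> 0) \<longrightarrow> Re (qform n A v) > 0)"

definition psd_mat :: "nat \<Rightarrow> complex mat \<Rightarrow> bool" where
  "psd_mat n A \<longleftrightarrow> hermitian_mat n A \<and> (\<forall>v. Re (qform n A v) \<ge> 0)"

definition mat_meromorphic_on :: "nat \<Rightarrow> (complex \<Rightarrow> complex mat) \<Rightarrow> complex set \<Rightarrow> bool" where
  "mat_meromorphic_on n F A \<longleftrightarrow> (\<forall>a<n. \<forall>b<n. (\<lambda>z. F z $$ (a, b)) meromorphic_on A)"

definition mat_analytic_at :: "nat \<Rightarrow> (complex \<Rightarrow> complex mat) \<Rightarrow> complex \<Rightarrow> bool" where
  "mat_analytic_at n F z \<longleftrightarrow> (\<forall>a<n. \<forall>b<n. (\<lambda>w. F w $$ (a, b)) analytic_on {z})"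

definition weyl_function ::
  "nat \<Rightarrow> (nat \<Rightarrow> complex mat) \<Rightarrow> nat \<Rightarrow> (complex \<Rightarrow> complex mat) \<Rightarrow> bool" where
  "weyl_function p C L \<phi> \<longleftrightarrow>
     (\<forall>z\<in>lower_half. \<phi> z \<in> carrier_mat p p) \<and>
     (\<forall>a<p. \<forall>b<p. (\<lambda>z. \<phi> z $$ (a, b)) holomorphic_on lower_half) \<and>
     (\<exists>R Q. (\<forall>z. R z \<in> carrier_mat p p \<and> Q z \<in> carrier_mat p p) \<and>
        mat_meromorphic_on p R lower_half \<and> mat_meromorphic_on p Q lower_half \<and>
        mat_analytic_at p R (- \<i>) \<and> mat_analytic_at p Q (- \<i>) \<and>
        (\<forall>z\<in>lower_half. mat_analytic_at p R z \<and> mat_analytic_at p Q z \<longrightarrow>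
            posdef_mat p (adj (R z) * R z + adj (Q z) * Q z) \<and>
            psd_mat p (adj (Q z) * Q z - adj (R z) * R z)) \<and>
        (\<forall>\<^sub>\<approx>z\<in>lower_half.
            (let Wz = calW p C L z;
                 M = blk p 0 0 Wz * R z + blk p 0 1 Wz * Q z;
                 N = blk p 1 0 Wz * R z + blk p 1 1 Wz * Q z
             in invertible_mat M \<and> \<phi> z * M = \<i> \<cdot>\<^sub>m N)))"

definition taylor_alpha :: "nat \<Rightarrow> (complex \<Rightarrow> complex mat) \<Rightarrow> nat \<Rightarrow> complex mat" where
  "taylor_alpha p \<phi> k = mat p p (\<lambda>(a, b).
      (deriv ^^ k) (\<lambda>z. \<i> * \<phi> (\<i> * (z + 1) / (z - 1)) $$ (a, b)) 0 / fact k)"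

end

theory Submission
  imports Defs "Jordan_Normal_Form.Determinant"
begin

text \<open>With \<open>B\<^sub>k = \<beta>(k) K\<close> the matrix \<open>P\<^sub>k = B\<^sub>k\<^sup>* B\<^sub>k j\<close> is a \<open>j\<close>-selfadjoint projection that
  determines \<open>C\<^sub>k = (2 P\<^sub>k - I) j\<close>, and at \<open>\<lambda> = i (z + 1) / (z - 1)\<close> the adjoint fundamental
  solution is, up to a scalar, the product of the factors \<open>I + (z - 1) P\<^sub>k\<close>. Hence
  \<open>Y(z) M(z) = \<Prod>\<^sub>k (I + (z - 1) P\<^sub>k) G(z)\<close> near \<open>z = 0\<close>, where \<open>G = [R; Q]\<close> and
  \<open>Y = K\<^sup>* [I; -i\<phi>]\<close>. At \<open>z = 0\<close> the columns of \<open>G\<close> span a \<open>j\<close>-nonpositive subspace, on which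
  \<open>I - P\<^sub>k\<close> is injective, and the range of \<open>I - P\<^sub>k\<close> is again \<open>j\<close>-nonpositive; so the right-hand
  side has full rank and \<open>M(0)\<close> is invertible. Once \<open>P\<^sub>0, \<dots>, P\<^sub>k\<^sub>-\<^sub>1\<close> are known, cancelling their
  factors costs a power \<open>z\<^sup>k\<close>, which the agreement of the Taylor coefficients up to order \<open>k\<close>
  absorbs. In the limit \<open>z \<rightarrow> 0\<close> this yields a \<open>p\<close>-dimensional subspace common to both systems on
  which both projections \<open>P\<^sub>k\<close> vanish, and a \<open>j\<close>-selfadjoint projection of rank \<open>p\<close> is determined
  by its kernel.\<close>

section \<open>Matrix algebra with dimension equations as side conditions\<close>

lemma mat_assoc_dim:
  fixes A :: "'a::semiring_0 mat"
  assumes "dim_col A = dim_row B" "dim_col B = dim_row C"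
  shows "A * B * C = A * (B * C)"
  using assms by (intro assoc_mult_mat[of _ "dim_row A" "dim_row B" _ "dim_row C" _ "dim_col C"]) auto

lemma mat_vec_assoc_dim:
  fixes A :: "'a::semiring_0 mat"
  assumes "dim_col A = dim_row B" "dim_col B = dim_vec v"
  shows "A * B *\<^sub>v v = A *\<^sub>v (B *\<^sub>v v)"
  using assms
  by (intro assoc_mult_mat_vec[of _ "dim_row A" "dim_row B" _ "dim_vec v"] carrier_matI carrier_vecI) auto

lemma mat_add_mult_dim:
  fixes A :: "'a::semiring_0 mat"
  assumes "dim_row A = dim_row B" "dim_col A = dim_col B" "dim_col B = dim_row C"
  shows "(A + B) * C = A * C + B * C"
  using assms
  by (intro add_mult_distrib_mat[of _ "dim_row A" "dim_col A" _ _ "dim_col C"] carrier_matI) auto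

lemma mat_mult_add_dim:
  fixes A :: "'a::semiring_0 mat"
  assumes "dim_row B = dim_row C" "dim_col B = dim_col C" "dim_col A = dim_row B"
  shows "A * (B + C) = A * B + A * C"
  using assms
  by (intro mult_add_distrib_mat[of _ "dim_row A" "dim_row C" _ "dim_col C"] carrier_matI) auto

lemma mat_minus_mult_dim:
  fixes A :: "'a::ring mat"
  assumes "dim_row A = dim_row B" "dim_col A = dim_col B" "dim_col B = dim_row C"
  shows "(A - B) * C = A * C - B * C"
  using assms
  by (intro minus_mult_distrib_mat[of _ "dim_row A" "dim_col A" _ _ "dim_col C"] carrier_matI) auto

lemma mat_mult_minus_dim:
  fixes A :: "'a::ring mat"
  assumes "dim_row B = dim_row C" "dim_col B = dim_col C" "dim_col A = dim_row B"
  shows "A * (B - C) = A * B - A * C"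
  using assms
  by (intro mult_minus_distrib_mat[of _ "dim_row A" "dim_row C" _ "dim_col C"] carrier_matI) auto

lemma mat_smult_mult_dim:
  fixes A :: "'a::comm_ring_1 mat"
  assumes "dim_col A = dim_row B"
  shows "(c \<cdot>\<^sub>m A) * B = c \<cdot>\<^sub>m (A * B)"
  using assms
  by (intro mult_smult_assoc_mat[of _ "dim_row A" "dim_col A" _ "dim_col B"] carrier_matI) auto

lemma mat_mult_smult_dim:
  fixes A :: "'a::comm_ring_1 mat"
  assumes "dim_col A = dim_row B"
  shows "A * (c \<cdot>\<^sub>m B) = c \<cdot>\<^sub>m (A * B)"
  using assms
  by (intro mult_smult_distrib[of _ "dim_row A" "dim_col A" _ "dim_col B"] carrier_matI) auto

lemma mat_minus_vec_dim:
  fixes A :: "'a::ring mat"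
  assumes "dim_row A = dim_row B" "dim_col A = dim_col B" "dim_col B = dim_vec v"
  shows "(A - B) *\<^sub>v v = A *\<^sub>v v - B *\<^sub>v v"
  using assms
  by (intro minus_mult_distrib_mat_vec[of _ "dim_row A" "dim_col A"] carrier_matI carrier_vecI) auto

lemma mat_add_vec_dim:
  fixes A :: "'a::ring mat"
  assumes "dim_row A = dim_row B" "dim_col A = dim_col B" "dim_col B = dim_vec v"
  shows "(A + B) *\<^sub>v v = A *\<^sub>v v + B *\<^sub>v v"
  using assms
  by (intro add_mult_distrib_mat_vec[of _ "dim_row A" "dim_col A"] carrier_matI carrier_vecI) auto

lemma mat_vec_minus_dim:
  fixes A :: "'a::ring mat"
  assumes "dim_vec v = dim_vec w" "dim_col A = dim_vec v"
  shows "A *\<^sub>v (v - w) = A *\<^sub>v v - A *\<^sub>v w"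
  using assms
  by (intro mult_minus_distrib_mat_vec[of _ "dim_row A" "dim_vec w"] carrier_matI carrier_vecI) auto

lemma mat_vec_add_dim:
  fixes A :: "'a::ring mat"
  assumes "dim_vec v = dim_vec w" "dim_col A = dim_vec v"
  shows "A *\<^sub>v (v + w) = A *\<^sub>v v + A *\<^sub>v w"
  using assms
  by (intro mult_add_distrib_mat_vec[of _ "dim_row A" "dim_vec w"] carrier_matI carrier_vecI) auto

lemma mat_smult_smult: "a \<cdot>\<^sub>m (b \<cdot>\<^sub>m A) = (a * b :: 'a::semigroup_mult) \<cdot>\<^sub>m A"
  by (rule eq_matI) (auto simp: mult.assoc)

lemma mat_one_smult: "(1::'a::monoid_mult) \<cdot>\<^sub>m A = A"
  by (rule eq_matI) auto

text \<open>The side conditions are equations between dimensions, which \<open>simp\<close> can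
  discharge; with carrier hypotheses the intermediate dimensions would have to be guessed at each
  rewrite.\<close>

lemmas mat_dim_simps =
  mat_assoc_dim mat_vec_assoc_dim mat_add_mult_dim mat_mult_add_dim mat_minus_mult_dim
  mat_mult_minus_dim mat_smult_mult_dim mat_mult_smult_dim mat_minus_vec_dim mat_add_vec_dim
  mat_vec_minus_dim mat_vec_add_dim

lemma mat_vec_zero: "(A::'a::semiring_0 mat) *\<^sub>v 0\<^sub>v (dim_col A) = 0\<^sub>v (dim_row A)"
  by (intro eq_vecI) auto

lemma zero_mat_vec: "n = dim_vec v \<Longrightarrow> (0\<^sub>m k n :: 'a::semiring_0 mat) *\<^sub>v v = 0\<^sub>v k"
  by (intro eq_vecI) auto

subsection \<open>Adjoints\<close>

lemma dim_adj [simp]: "dim_row (adj A) = dim_col A" "dim_col (adj A) = dim_row A"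
  by (simp_all add: adj_def)

lemma adj_carrier [simp]: "A \<in> carrier_mat n m \<Longrightarrow> adj A \<in> carrier_mat m n"
  by (simp add: adj_def)

lemma index_adj [simp]: "i < dim_col A \<Longrightarrow> j < dim_row A \<Longrightarrow> adj A $$ (i, j) = cnj (A $$ (j, i))"
  by (simp add: adj_def)

lemma adj_adj [simp]: "adj (adj A) = A"
  by (rule eq_matI) auto

lemma adj_one [simp]: "adj (1\<^sub>m n) = 1\<^sub>m n"
  by (rule eq_matI) auto

lemma adj_uminus: "adj (- A) = - adj A"
  by (rule eq_matI) auto

lemma adj_smult: "adj (c \<cdot>\<^sub>m A) = cnj c \<cdot>\<^sub>m adj A"
  by (rule eq_matI) auto

lemma adj_minus:
  "dim_row A = dim_row B \<Longrightarrow> dim_col A = dim_col B \<Longrightarrow> adj (A - B) = adj A - adj B"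
  by (rule eq_matI) auto

lemma adj_mult: "dim_col A = dim_row B \<Longrightarrow> adj (A * B) = adj B * adj A"
  by (rule eq_matI) (auto simp: scalar_prod_def mult.commute)

lemma adj_four_block:
  assumes "A \<in> carrier_mat a b" "B \<in> carrier_mat a c" "C \<in> carrier_mat d b" "D \<in> carrier_mat d c"
  shows "adj (four_block_mat A B C D) = four_block_mat (adj A) (adj C) (adj B) (adj D)"
  using assms by (intro eq_matI) auto

lemma cscalar_adj:
  fixes A :: "complex mat"
  assumes "dim_row A = dim_vec x" "dim_col A = dim_vec y"
  shows "(A *\<^sub>v y) \<bullet>c x = y \<bullet>c (adj A *\<^sub>v x)"
proof -
  have "(A *\<^sub>v y) \<bullet>c x = (\<Sum>i<dim_vec x. \<Sum>j<dim_vec y. A $$ (i, j) * y $ j * cnj (x $ i))"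
    using assms by (simp add: scalar_prod_def lessThan_atLeast0 sum_distrib_right)
  also have "\<dots> = (\<Sum>j<dim_vec y. \<Sum>i<dim_vec x. A $$ (i, j) * y $ j * cnj (x $ i))"
    by (rule sum.swap)
  also have "\<dots> = y \<bullet>c (adj A *\<^sub>v x)"
    using assms by (simp add: scalar_prod_def lessThan_atLeast0 sum_distrib_left mult_ac)
  finally show ?thesis .
qed

lemma Re_cscalar_self: "Re (v \<bullet>c v) = (\<Sum>i<dim_vec v. (cmod (v $ i))\<^sup>2)"
  by (simp add: scalar_prod_def lessThan_atLeast0 cmod_power2 flip: power2_eq_square)

lemma cscalar_self_nonpos: "Re (v \<bullet>c (v::complex vec)) \<le> 0 \<Longrightarrow> v = 0\<^sub>v (dim_vec v)"
proof -
  assume "Re (v \<bullet>c v) \<le> 0"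
  then have "(\<Sum>i<dim_vec v. (cmod (v $ i))\<^sup>2) = 0"
    by (metis Re_cscalar_self antisym sum_nonneg zero_le_power2)
  then show ?thesis
    by (subst (asm) sum_nonneg_eq_0_iff) (auto intro!: eq_vecI)
qed

lemma Re_cscalar_commute:
  "dim_vec x = dim_vec y \<Longrightarrow> Re (x \<bullet>c y) = Re (y \<bullet>c (x::complex vec))"
  by (simp add: scalar_prod_def mult_ac)

subsection \<open>Injective matrices\<close>

text \<open>Trivial kernel, that is, full column rank; it is applied to \<open>2p\<close> by
  \<open>p\<close> frames as well as to square matrices.\<close>

definition inj_mat :: "'a::semiring_0 mat \<Rightarrow> bool" where
  "inj_mat A \<longleftrightarrow> (\<forall>v. dim_vec v = dim_col A \<longrightarrow> A *\<^sub>v v = 0\<^sub>v (dim_row A) \<longrightarrow> v = 0\<^sub>v (dim_col A))"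

lemma inj_mat_det:
  fixes A :: "complex mat"
  assumes "A \<in> carrier_mat n n" "inj_mat A"
  shows "det A \<noteq> 0"
proof
  assume "det A = 0"
  then obtain v where "v \<in> carrier_vec n" "v \<noteq> 0\<^sub>v n" "A *\<^sub>v v = 0\<^sub>v n"
    using det_0_iff_vec_prod_zero[OF assms(1)] by blast
  then show False
    using assms unfolding inj_mat_def by (metis carrier_matD carrier_vecD)
qed

lemma inj_mat_right_inverse:
  fixes A :: "complex mat"
  assumes A: "A \<in> carrier_mat n n" and "inj_mat A"
  obtains S where "S \<in> carrier_mat n n" "A * S = 1\<^sub>m n"
proof
  have "det A \<noteq> 0" using assms by (rule inj_mat_det)
  then show "A * ((1 / det A) \<cdot>\<^sub>m adj_mat A) = 1\<^sub>m n"
    using adj_mat[OF A] A by (auto simp: mat_mult_smult_dim intro!: eq_matI)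
  show "(1 / det A) \<cdot>\<^sub>m adj_mat A \<in> carrier_mat n n" using adj_mat[OF A] by simp
qed

lemma inj_mat_factor:
  fixes A B :: "complex mat"
  assumes "inj_mat (A * B)" "dim_col A = dim_row B"
  shows "inj_mat B"
  unfolding inj_mat_def
proof (intro allI impI)
  fix v :: "complex vec"
  assume v: "dim_vec v = dim_col B" "B *\<^sub>v v = 0\<^sub>v (dim_row B)"
  then have "A * B *\<^sub>v v = 0\<^sub>v (dim_row (A * B))"
    using assms mat_vec_zero[of A] by (simp add: mat_vec_assoc_dim)
  then show "v = 0\<^sub>v (dim_col B)"
    using assms v by (auto simp: inj_mat_def)
qed

subsection \<open>The signature matrix and J-projections\<close>

lemma dim_jmat [simp]: "dim_row (jmat p) = 2 * p" "dim_col (jmat p) = 2 * p"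
  by (auto simp: jmat_def)

lemma dim_Kmat [simp]: "dim_row (Kmat p) = 2 * p" "dim_col (Kmat p) = 2 * p"
  by (auto simp: Kmat_def)

lemma adj_jmat [simp]: "adj (jmat p) = jmat p"
  unfolding jmat_def by (rule eq_matI) auto

lemma jmat_jmat [simp]: "jmat p * jmat p = 1\<^sub>m (2 * p)"
  unfolding jmat_def
  by (subst mult_four_block_mat[of _ p p _ p _ p _ _ p _ p]) (auto intro!: eq_matI)

lemma inverse_sqrt2_square:
  "complex_of_real (1 / sqrt 2) * complex_of_real (1 / sqrt 2) = 1 / 2"
  by (simp flip: of_real_mult)

lemma adj_Kmat:
  "adj (Kmat p) = complex_of_real (1 / sqrt 2) \<cdot>\<^sub>m
     four_block_mat (1\<^sub>m p) (1\<^sub>m p) (- 1\<^sub>m p) (1\<^sub>m p)"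
  unfolding Kmat_def by (simp add: adj_smult adj_four_block[of _ p p _ p _ p] adj_uminus)

lemma Kmat_unitary: "adj (Kmat p) * Kmat p = 1\<^sub>m (2 * p)"
proof -
  have "four_block_mat (1\<^sub>m p) (1\<^sub>m p) (- 1\<^sub>m p) (1\<^sub>m p) *
      four_block_mat (1\<^sub>m p) (- 1\<^sub>m p) (1\<^sub>m p) (1\<^sub>m p) = (2::complex) \<cdot>\<^sub>m 1\<^sub>m (2 * p)"
    by (subst mult_four_block_mat[of _ p p _ p _ p _ _ p _ p]) (auto intro!: eq_matI)
  then have "adj (Kmat p) * Kmat p =
      (complex_of_real (1 / sqrt 2) * complex_of_real (1 / sqrt 2)) \<cdot>\<^sub>m (2 \<cdot>\<^sub>m 1\<^sub>m (2 * p))"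
    unfolding adj_Kmat unfolding Kmat_def
    by (simp add: mat_smult_mult_dim mat_mult_smult_dim mat_smult_smult)
  then show ?thesis
    unfolding inverse_sqrt2_square by (simp add: mat_smult_smult mat_one_smult)
qed

lemma Kmat_jmat: "Kmat p * jmat p * adj (Kmat p) = Jmat p"
proof -
  have "four_block_mat (1\<^sub>m p) (- 1\<^sub>m p) (1\<^sub>m p) (1\<^sub>m p) * jmat p =
      four_block_mat (1\<^sub>m p) (1\<^sub>m p) (1\<^sub>m p) (- 1\<^sub>m p)"
    unfolding jmat_def
    by (subst mult_four_block_mat[of _ p p _ p _ p _ _ p _ p]) (auto intro!: eq_matI)
  moreover have "four_block_mat (1\<^sub>m p) (1\<^sub>m p) (1\<^sub>m p) (- 1\<^sub>m p) *
      four_block_mat (1\<^sub>m p) (1\<^sub>m p) (- 1\<^sub>m p) (1\<^sub>m p) = 2 \<cdot>\<^sub>m Jmat p"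
    unfolding Jmat_def
    by (subst mult_four_block_mat[of _ p p _ p _ p _ _ p _ p]) (auto intro!: eq_matI)
  ultimately have "Kmat p * jmat p * adj (Kmat p) =
      (complex_of_real (1 / sqrt 2) * complex_of_real (1 / sqrt 2)) \<cdot>\<^sub>m (2 \<cdot>\<^sub>m Jmat p)"
    unfolding adj_Kmat unfolding Kmat_def
    by (simp add: mat_smult_mult_dim mat_mult_smult_dim mat_smult_smult)
  then show ?thesis
    unfolding inverse_sqrt2_square by (simp add: mat_smult_smult mat_one_smult)
qed

text \<open>The indefinite quadratic form \<open>x\<^sup>* j x\<close> of signature
  \<open>(p, p)\<close>.\<close>

definition jform :: "nat \<Rightarrow> complex vec \<Rightarrow> real" where
  "jform p x = Re ((jmat p *\<^sub>v x) \<bullet>c x)"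

lemma jmat_vec_index:
  assumes "dim_vec x = 2 * p" "i < 2 * p"
  shows "(jmat p *\<^sub>v x) $ i = (if i < p then x $ i else - x $ i)"
proof -
  have "(jmat p *\<^sub>v x) $ i = (\<Sum>k\<in>{0..<2*p}. jmat p $$ (i, k) * x $ k)"
    using assms by (simp add: scalar_prod_def)
  also have "\<dots> = (\<Sum>k\<in>{0..<2*p}. if k = i then (if i < p then x $ i else - x $ i) else 0)"
    using assms by (intro sum.cong) (auto simp: jmat_def)
  also have "\<dots> = (if i < p then x $ i else - x $ i)"
    using assms by simp
  finally show ?thesis .
qed

lemma sum_two_blocks:
  fixes f :: "nat \<Rightarrow> 'a::comm_monoid_add"
  shows "sum f {0..<2*p} = sum f {0..<p} + sum (\<lambda>i. f (p + i)) {0..<p}"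
proof -
  have "sum f {0..<p+p} = sum f {0..<p} + sum f {p..<p+p}"
    by (simp add: sum.atLeastLessThan_concat)
  also have "sum f {p..<p+p} = sum (\<lambda>i. f (p + i)) {0..<p}"
    using sum.shift_bounds_nat_ivl[of f 0 p p] by (simp add: add.commute)
  finally show ?thesis by (simp add: mult_2)
qed

lemma jform_eq:
  assumes "dim_vec x = 2 * p"
  shows "jform p x = (\<Sum>i\<in>{0..<p}. (cmod (x $ i))\<^sup>2) - (\<Sum>i\<in>{0..<p}. (cmod (x $ (p + i)))\<^sup>2)"
  using assms
  by (simp add: jform_def scalar_prod_def sum_two_blocks jmat_vec_index cmod_power2 sum_negf
      del: index_mult_mat_vec flip: power2_eq_square)

text \<open>The coordinate projections are encoded as matrices so that they can be composed with
  other matrices, both to extract a half and to assemble a block row.\<close>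

definition top_mat :: "nat \<Rightarrow> complex mat" where
  "top_mat p = mat p (2 * p) (\<lambda>(i, j). if j = i then 1 else 0)"

definition bot_mat :: "nat \<Rightarrow> complex mat" where
  "bot_mat p = mat p (2 * p) (\<lambda>(i, j). if j = p + i then 1 else 0)"

lemma dim_top_bot [simp]:
  "dim_row (top_mat p) = p" "dim_col (top_mat p) = 2 * p"
  "dim_row (bot_mat p) = p" "dim_col (bot_mat p) = 2 * p"
  by (simp_all add: top_mat_def bot_mat_def)

lemma top_mat_vec_index: "dim_vec x = 2 * p \<Longrightarrow> i < p \<Longrightarrow> (top_mat p *\<^sub>v x) $ i = x $ i"
  by (simp add: top_mat_def scalar_prod_def if_distrib[of "\<lambda>c. c * _"] cong: if_cong)

lemma bot_mat_vec_index: "dim_vec x = 2 * p \<Longrightarrow> i < p \<Longrightarrow> (bot_mat p *\<^sub>v x) $ i = x $ (p + i)"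
  by (simp add: bot_mat_def scalar_prod_def if_distrib[of "\<lambda>c. c * _"] cong: if_cong)

lemma top_bot_zero:
  assumes x: "dim_vec x = 2 * p" and t: "top_mat p *\<^sub>v x = 0\<^sub>v p" and b: "bot_mat p *\<^sub>v x = 0\<^sub>v p"
  shows "x = 0\<^sub>v (2 * p)"
proof (rule eq_vecI)
  fix i assume i: "i < dim_vec (0\<^sub>v (2 * p) :: complex vec)"
  show "x $ i = 0\<^sub>v (2 * p) $ i"
  proof (cases "i < p")
    case True
    then show ?thesis using top_mat_vec_index[OF x True] t i by simp
  next
    case False
    then have "i - p < p" "p + (i - p) = i" using i by auto
    then show ?thesis using bot_mat_vec_index[OF x, of "i - p"] b i by simp
  qed
qed (use x in simp)

lemma jform_top_zero:
  assumes "dim_vec x = 2 * p" "top_mat p *\<^sub>v x = 0\<^sub>v p"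
  shows "jform p x \<le> 0"
proof -
  have "x $ i = 0" if "i < p" for i
    using top_mat_vec_index[OF assms(1) that] assms(2) that by simp
  then show ?thesis
    by (simp add: jform_eq assms(1) sum_nonneg)
qed

section \<open>j-normalised rows and the projections they define\<close>

definition jnormal :: "nat \<Rightarrow> complex mat \<Rightarrow> bool" where
  "jnormal p B \<longleftrightarrow> B \<in> carrier_mat p (2 * p) \<and> B * jmat p * adj B = 1\<^sub>m p"

definition jproj :: "nat \<Rightarrow> complex mat \<Rightarrow> complex mat" where
  "jproj p B = adj B * B * jmat p"

lemma jnormal_dim: "jnormal p B \<Longrightarrow> dim_row B = p" "jnormal p B \<Longrightarrow> dim_col B = 2 * p"
  by (auto simp: jnormal_def)

lemma dim_jproj: "jnormal p B \<Longrightarrow> dim_row (jproj p B) = 2 * p" "jnormal p B \<Longrightarrow> dim_col (jproj p B) = 2 * p"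
  by (auto simp: jnormal_def jproj_def)

lemma jnormal_mult: "jnormal p B \<Longrightarrow> B * (jmat p * adj B) = 1\<^sub>m p"
  by (auto simp: jnormal_def mat_assoc_dim)

lemma jnormal_mult_left:
  "jnormal p B \<Longrightarrow> dim_row X = p \<Longrightarrow> B * (jmat p * (adj B * X)) = X"
  using jnormal_mult[of p B] jnormal_dim[of p B]
    mat_assoc_dim[of B "jmat p * adj B" X] mat_assoc_dim[of "jmat p" "adj B" X]
  by simp

lemma jnormal_mult_vec:
  "jnormal p B \<Longrightarrow> dim_vec x = p \<Longrightarrow> B *\<^sub>v (jmat p *\<^sub>v (adj B *\<^sub>v x)) = x"
  using jnormal_mult[of p B] jnormal_dim[of p B] one_mult_mat_vec[OF carrier_vecI[of x p]]
    mat_vec_assoc_dim[of B "jmat p * adj B" x] mat_vec_assoc_dim[of "jmat p" "adj B" x]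
  by simp

text \<open>Moving \<open>B\<close> and \<open>j\<close> across the inner product produces
  \<open>B j B\<^sup>* = I\<close>. Hence the range of the projection \<open>jproj p B\<close> is
  j-positive.\<close>

lemma jform_adj:
  assumes "jnormal p B" "dim_vec y = p"
  shows "jform p (adj B *\<^sub>v y) = Re (y \<bullet>c y)"
proof -
  have "jform p (adj B *\<^sub>v y) = Re ((adj B *\<^sub>v y) \<bullet>c (jmat p *\<^sub>v (adj B *\<^sub>v y)))"
    using assms jnormal_dim[OF assms(1)] by (simp add: jform_def cscalar_adj)
  also have "\<dots> = Re (y \<bullet>c (B *\<^sub>v (jmat p *\<^sub>v (adj B *\<^sub>v y))))"
    using assms jnormal_dim[OF assms(1)] by (subst cscalar_adj) auto
  finally show ?thesis
    using assms by (simp add: jnormal_mult_vec)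
qed

text \<open>If the top half of \<open>adj B v\<close> vanishes, its \<open>jform\<close> is
  nonpositive, yet by \<open>jform_adj\<close> it equals the squared norm of \<open>v\<close>. So
  the top half of \<open>adj B\<close> is an invertible square matrix.\<close>

lemma jnormal_top_inj:
  assumes "jnormal p B"
  shows "inj_mat (top_mat p * adj B)"
  unfolding inj_mat_def
proof (intro allI impI)
  note d = jnormal_dim[OF assms]
  fix v :: "complex vec"
  assume v: "dim_vec v = dim_col (top_mat p * adj B)"
    "top_mat p * adj B *\<^sub>v v = 0\<^sub>v (dim_row (top_mat p * adj B))"
  then have "jform p (adj B *\<^sub>v v) \<le> 0"
    using d by (intro jform_top_zero) (auto simp: mat_vec_assoc_dim)
  then show "v = 0\<^sub>v (dim_col (top_mat p * adj B))"
    using jform_adj[OF assms, of v] cscalar_self_nonpos[of v] v d by simp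
qed

lemma cscalar_minus_minus:
  fixes a b x y :: "complex vec"
  assumes "dim_vec a = n" "dim_vec b = n" "dim_vec x = n" "dim_vec y = n"
  shows "(a - b) \<bullet>c (x - y) = a \<bullet>c x - a \<bullet>c y - b \<bullet>c x + b \<bullet>c y"
proof -
  have "(a - b) \<bullet>c (x - y)
      = (\<Sum>i\<in>{0..<n}. a $ i * cnj (x $ i) - a $ i * cnj (y $ i) - b $ i * cnj (x $ i) + b $ i * cnj (y $ i))"
    unfolding scalar_prod_def using assms by (intro sum.cong) (auto simp: algebra_simps)
  also have "\<dots> = a \<bullet>c x - a \<bullet>c y - b \<bullet>c x + b \<bullet>c y"
    unfolding scalar_prod_def using assms by (simp add: sum.distrib sum_subtractf)
  finally show ?thesis .
qed

text \<open>The two cross terms have equal real parts because \<open>j\<close> is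
  selfadjoint.\<close>

lemma jform_minus:
  assumes "dim_vec x = 2 * p" "dim_vec y = 2 * p"
  shows "jform p (x - y) = jform p x + jform p y - 2 * Re ((jmat p *\<^sub>v y) \<bullet>c x)"
proof -
  have "Re ((jmat p *\<^sub>v x) \<bullet>c y) = Re (x \<bullet>c (jmat p *\<^sub>v y))"
    using assms by (subst cscalar_adj) auto
  also have "\<dots> = Re ((jmat p *\<^sub>v y) \<bullet>c x)"
    using assms by (intro Re_cscalar_commute) auto
  finally have "Re ((jmat p *\<^sub>v x) \<bullet>c y) = Re ((jmat p *\<^sub>v y) \<bullet>c x)" .
  then show ?thesis
    using assms unfolding jform_def by (simp add: mat_vec_minus_dim cscalar_minus_minus)
qed

text \<open>Choose \<open>y\<close> so that \<open>u = adj B y\<close> and \<open>x\<close> have the same top half. Then \<open>jform (u - x) \<le> 0\<close>, while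
  \<open>jform (u - x) = jform x + |y|\<^sup>2\<close> because \<open>u\<close> is \<open>j\<close>-orthogonal to \<open>x\<close>.\<close>
lemma jform_kernel_nonpos:
  assumes B: "jnormal p B" and x: "dim_vec x = 2 * p" and k: "B *\<^sub>v (jmat p *\<^sub>v x) = 0\<^sub>v p"
  shows "jform p x \<le> 0"
proof -
  note d = jnormal_dim[OF B]
  have "top_mat p * adj B \<in> carrier_mat p p"
    using d by (intro carrier_matI) auto
  then obtain S where S: "S \<in> carrier_mat p p" "top_mat p * adj B * S = 1\<^sub>m p"
    using jnormal_top_inj[OF B] by (rule inj_mat_right_inverse)
  define y where "y = S *\<^sub>v (top_mat p *\<^sub>v x)"
  define u where "u = adj B *\<^sub>v y"
  have y: "dim_vec y = p" and u: "dim_vec u = 2 * p"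
    using S d by (auto simp: y_def u_def)
  have "top_mat p *\<^sub>v u = (top_mat p * adj B * S) *\<^sub>v (top_mat p *\<^sub>v x)"
    using S(1) d x by (simp add: u_def y_def mat_vec_assoc_dim)
  also have "\<dots> = top_mat p *\<^sub>v x"
    unfolding S(2) using x by (intro one_mult_mat_vec carrier_vecI) simp
  finally have "top_mat p *\<^sub>v (u - x) = 0\<^sub>v p"
    using u x by (simp add: mat_vec_minus_dim) (auto intro!: eq_vecI)
  then have "jform p (u - x) \<le> 0"
    using u x by (intro jform_top_zero) auto
  moreover have "(jmat p *\<^sub>v x) \<bullet>c u = 0"
  proof -
    have "(jmat p *\<^sub>v x) \<bullet>c u = (B *\<^sub>v (jmat p *\<^sub>v x)) \<bullet>c y"
      unfolding u_def using d y by (subst cscalar_adj) auto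
    then show ?thesis
      unfolding k using y by (simp add: scalar_prod_def)
  qed
  moreover have "jform p u \<ge> 0"
    unfolding u_def jform_adj[OF B y] Re_cscalar_self by (simp add: sum_nonneg)
  ultimately show ?thesis
    using jform_minus[OF u x] by simp
qed

text \<open>The range of \<open>I - P\<close> lies in the kernel of \<open>B j\<close>, since
  \<open>B j P = B j\<close>.\<close>

lemma jproj_compl_nonpos:
  assumes B: "jnormal p B" and x: "dim_vec x = 2 * p"
  shows "jform p ((1\<^sub>m (2 * p) - jproj p B) *\<^sub>v x) \<le> 0"
proof (rule jform_kernel_nonpos[OF B])
  note d = jnormal_dim[OF B]
  show "B *\<^sub>v (jmat p *\<^sub>v ((1\<^sub>m (2 * p) - jproj p B) *\<^sub>v x)) = 0\<^sub>v p"
    using d x by (simp add: jproj_def mat_dim_simps jnormal_mult_vec[OF B] one_mult_mat_vec[OF carrier_vecI])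
      (auto intro!: eq_vecI)
qed (use dim_jproj[OF B] in simp)

text \<open>A vector killed by \<open>I - P\<close> is \<open>adj B w\<close> with
  \<open>w = B j x\<close>, so its \<open>jform\<close> is the squared norm of \<open>w\<close>;
  nonpositivity forces \<open>w = 0\<close>.\<close>

lemma jproj_compl_inj:
  assumes B: "jnormal p B" and x: "dim_vec x = 2 * p" and n: "jform p x \<le> 0"
    and z: "(1\<^sub>m (2 * p) - jproj p B) *\<^sub>v x = 0\<^sub>v (2 * p)"
  shows "x = 0\<^sub>v (2 * p)"
proof -
  note d = jnormal_dim[OF B]
  let ?w = "B *\<^sub>v (jmat p *\<^sub>v x)"
  have "x - adj B *\<^sub>v ?w = 0\<^sub>v (2 * p)"
    using z d x by (simp add: jproj_def mat_dim_simps one_mult_mat_vec[OF carrier_vecI])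
  then have x': "x = adj B *\<^sub>v ?w"
    using d x by (intro eq_vecI) (auto simp: vec_eq_iff)
  have "jform p x = Re (?w \<bullet>c ?w)"
    using jform_adj[OF B, of ?w] x' d by simp
  then have "?w = 0\<^sub>v p"
    using n cscalar_self_nonpos[of ?w] d by simp
  then show ?thesis
    using x' mat_vec_zero[of "adj B"] d by simp
qed

lemma mat_minus_eq_zero:
  fixes A B :: "'a::group_add mat"
  assumes "A - B = 0\<^sub>m n m" "dim_row A = n" "dim_col A = m" "dim_row B = n" "dim_col B = m"
  shows "A = B"
proof (rule eq_matI)
  fix i j assume "i < dim_row B" "j < dim_col B"
  then show "A $$ (i, j) = B $$ (i, j)"
    using arg_cong[OF assms(1), of "\<lambda>M. M $$ (i, j)"] assms(2-) by simp
qed (use assms in auto)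

lemma jmat_cancel: "dim_row X = 2 * p \<Longrightarrow> jmat p * (jmat p * X) = X"
  using mat_assoc_dim[of "jmat p" "jmat p" X] by simp

lemma jproj_idem: "jnormal p B \<Longrightarrow> jproj p B * jproj p B = jproj p B"
  using jnormal_dim[of p B] by (simp add: jproj_def mat_dim_simps jnormal_mult_left)

lemma jproj_adj: "jnormal p B \<Longrightarrow> adj (jproj p B) = jmat p * jproj p B * jmat p"
  using jnormal_dim[of p B] by (simp add: jproj_def mat_dim_simps adj_mult)

text \<open>The columns of \<open>X\<close> span a common complement of both ranges inside both
  kernels, which gives \<open>P1 P2 = P1\<close> and \<open>P2 P1 = P2\<close>. Taking adjoints,
  j-selfadjointness turns the first relation into \<open>P2 P1 = P1\<close>.\<close>

lemma jproj_kernel_unique: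
  assumes B1: "jnormal p B1" and B2: "jnormal p B2"
    and X: "X \<in> carrier_mat (2 * p) p" and inj: "inj_mat X"
    and X1: "jproj p B1 * X = 0\<^sub>m (2 * p) p" and X2: "jproj p B2 * X = 0\<^sub>m (2 * p) p"
  shows "jproj p B1 = jproj p B2"
proof -
  have *: "jproj p B * jproj p C = jproj p B"
    if B: "jnormal p B" and C: "jnormal p C" and BX: "jproj p B * X = 0\<^sub>m (2 * p) p"
      and CX: "jproj p C * X = 0\<^sub>m (2 * p) p" for B C
  proof -
    note d = jnormal_dim[OF B] jnormal_dim[OF C] X
    \<comment> \<open>This is the square block row \<open>[adj C, X]\<close>. Its invertibility says
      that the range of \<open>jproj p C\<close> and the columns of \<open>X\<close> together span
      the whole space.\<close>
    define T where "T = adj C * top_mat p + X * bot_mat p"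
    have T: "T \<in> carrier_mat (2 * p) (2 * p)"
      using d by (auto simp: T_def)
    have C0: "C * (jmat p * X) = 0\<^sub>m p p"
    proof -
      have "C * (jmat p * X) = C * jmat p * (jproj p C * X)"
        using d jnormal_mult_left[OF C, of "C * (jmat p * X)"] by (simp add: jproj_def mat_dim_simps)
      then show ?thesis unfolding CX using d by simp
    qed
    have "inj_mat T"
      unfolding inj_mat_def
    proof (intro allI impI)
      fix v assume v: "dim_vec v = dim_col T" "T *\<^sub>v v = 0\<^sub>v (dim_row T)"
      have v': "dim_vec v = 2 * p" using v T by simp
      let ?a = "top_mat p *\<^sub>v v" and ?b = "bot_mat p *\<^sub>v v"
      have 1: "adj C *\<^sub>v ?a + X *\<^sub>v ?b = 0\<^sub>v (2 * p)"
        using v v' T d by (simp add: T_def mat_dim_simps)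
      \<comment> \<open>Applying \<open>C j\<close> isolates the coefficient \<open>?a\<close>,
        because \<open>C j C\<^sup>* = I\<close> and \<open>C j X = 0\<close>; injectivity of
        \<open>X\<close> then removes \<open>?b\<close>.\<close>
      have "C *\<^sub>v (jmat p *\<^sub>v (adj C *\<^sub>v ?a + X *\<^sub>v ?b)) = ?a + (C * (jmat p * X)) *\<^sub>v ?b"
        using v' d by (simp add: mat_dim_simps jnormal_mult_vec[OF C])
      also have "\<dots> = ?a"
        unfolding C0 using v' by (simp add: zero_mat_vec right_zero_vec[OF carrier_vecI])
      also have "C *\<^sub>v (jmat p *\<^sub>v (adj C *\<^sub>v ?a + X *\<^sub>v ?b)) = 0\<^sub>v p"
        unfolding 1 using mat_vec_zero[of "jmat p"] mat_vec_zero[of C] d by simp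
      finally have a: "?a = 0\<^sub>v p" by simp
      then have "X *\<^sub>v ?b = 0\<^sub>v (2 * p)"
        using 1 mat_vec_zero[of "adj C"] d carrier_vecI[of "X *\<^sub>v ?b" "2 * p"] by simp
      then have "?b = 0\<^sub>v p"
        using inj d unfolding inj_mat_def by simp
      then show "v = 0\<^sub>v (dim_col T)"
        using top_bot_zero[OF v' a] T by simp
    qed
    then obtain S where S: "S \<in> carrier_mat (2 * p) (2 * p)" "T * S = 1\<^sub>m (2 * p)"
      by (rule inj_mat_right_inverse[OF T])
    let ?Q = "1\<^sub>m (2 * p) - jproj p C"
    \<comment> \<open>The complement \<open>?Q\<close> kills the block \<open>adj C\<close> of
      \<open>T\<close>, so only the block \<open>X\<close> survives; on that block both projections
      vanish.\<close>
    have "jproj p B * (?Q * (T * S)) = jproj p B * (?Q * X) * (bot_mat p * S)"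
    proof -
      have "?Q * adj C = 0\<^sub>m (2 * p) p"
        using d jnormal_mult[OF C]
        by (simp add: jproj_def mat_dim_simps minus_r_inv_mat[OF carrier_matI])
      then have "?Q * (adj C * (top_mat p * S)) = 0\<^sub>m (2 * p) (2 * p)"
        using d S(1) dim_jproj[OF C] mat_assoc_dim[of ?Q "adj C" "top_mat p * S"] by simp
      then have "?Q * (T * S) = ?Q * X * (bot_mat p * S)"
        using d S(1) dim_jproj[OF C] unfolding T_def
        by (simp add: mat_assoc_dim mat_add_mult_dim mat_mult_add_dim left_add_zero_mat[OF carrier_matI])
      then show ?thesis
        using d S(1) dim_jproj[OF C] dim_jproj[OF B] by (simp add: mat_assoc_dim)
    qed
    moreover have "jproj p B * (?Q * X) = 0\<^sub>m (2 * p) p"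
      using d dim_jproj[OF C] dim_jproj[OF B] by (simp add: mat_dim_simps CX BX)
    ultimately have "jproj p B * ?Q = 0\<^sub>m (2 * p) (2 * p)"
      unfolding S(2) using S(1) dim_jproj[OF C] dim_jproj[OF B] by simp
    then have "jproj p B - jproj p B * jproj p C = 0\<^sub>m (2 * p) (2 * p)"
      using dim_jproj[OF C] dim_jproj[OF B] by (simp add: mat_dim_simps)
    then have "jproj p B = jproj p B * jproj p C"
      by (rule mat_minus_eq_zero) (simp_all add: dim_jproj[OF C] dim_jproj[OF B])
    then show ?thesis by (rule sym)
  qed
  note d = dim_jproj[OF B1] dim_jproj[OF B2]
  have "jproj p B1 * jproj p B2 = jproj p B1" "jproj p B2 * jproj p B1 = jproj p B2"
    using * B1 B2 X1 X2 by blast+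
  then have "adj (jproj p B1 * jproj p B2) = adj (jproj p B1)" by simp
  \<comment> \<open>The adjoint reverses the product, and each adjoint projection is
    \<open>j P j\<close>; the inner pair of \<open>j\<close> cancels.\<close>
  then have "jmat p * (jproj p B2 * jproj p B1) * jmat p = jmat p * jproj p B1 * jmat p"
    using d by (simp add: adj_mult jproj_adj B1 B2 mat_assoc_dim jmat_cancel)
  then have "jmat p * (jmat p * (jproj p B2 * jproj p B1) * jmat p) * jmat p
      = jmat p * (jmat p * jproj p B1 * jmat p) * jmat p" by simp
  then have "jproj p B2 * jproj p B1 = jproj p B1"
    using d by (simp add: mat_assoc_dim jmat_cancel)
  then show ?thesis
    using \<open>jproj p B2 * jproj p B1 = jproj p B2\<close> by simp
qed

subsection \<open>Entrywise limits of matrices\<close>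

text \<open>The shape of \<open>F z\<close> is required for every \<open>z\<close>, not just
  eventually, so that entries of sums and products can be unfolded without restricting
  \<open>z\<close>.\<close>

definition mat_lim ::
  "nat \<Rightarrow> nat \<Rightarrow> ('a \<Rightarrow> complex mat) \<Rightarrow> complex mat \<Rightarrow> 'a filter \<Rightarrow> bool" where
  "mat_lim n m F A l \<longleftrightarrow> A \<in> carrier_mat n m \<and> (\<forall>z. F z \<in> carrier_mat n m) \<and>
     (\<forall>i<n. \<forall>j<m. ((\<lambda>z. F z $$ (i, j)) \<longlongrightarrow> A $$ (i, j)) l)"

lemma mat_lim_carrier:
  assumes "mat_lim n m F A l"
  shows "A \<in> carrier_mat n m" "F z \<in> carrier_mat n m"
  using assms by (auto simp: mat_lim_def)

lemma mat_lim_const: "A \<in> carrier_mat n m \<Longrightarrow> mat_lim n m (\<lambda>z. A) A l"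
  by (simp add: mat_lim_def)

lemma mat_lim_mult:
  assumes "mat_lim n k F A l" "mat_lim k m G B l"
  shows "mat_lim n m (\<lambda>z. F z * G z) (A * B) l"
proof -
  have c: "A \<in> carrier_mat n k" "B \<in> carrier_mat k m"
    "F z \<in> carrier_mat n k" "G z \<in> carrier_mat k m" for z
    using assms by (auto simp: mat_lim_def)
  have "((\<lambda>z. \<Sum>x\<in>{0..<k}. F z $$ (i, x) * G z $$ (x, j)) \<longlongrightarrow> (\<Sum>x\<in>{0..<k}. A $$ (i, x) * B $$ (x, j))) l"
    if "i < n" "j < m" for i j
    using assms that by (intro tendsto_sum tendsto_mult) (auto simp: mat_lim_def)
  moreover have "(F z * G z) $$ (i, j) = (\<Sum>x\<in>{0..<k}. F z $$ (i, x) * G z $$ (x, j))"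
    "(A * B) $$ (i, j) = (\<Sum>x\<in>{0..<k}. A $$ (i, x) * B $$ (x, j))" if "i < n" "j < m" for i j z
    using c(1,2) c(3,4)[of z] that by (simp_all add: scalar_prod_def)
  ultimately show ?thesis
    using c by (auto simp: mat_lim_def intro!: mult_carrier_mat[of _ n k])
qed

lemma mat_lim_add:
  assumes "mat_lim n m F A l" "mat_lim n m G B l"
  shows "mat_lim n m (\<lambda>z. F z + G z) (A + B) l"
  using assms by (auto simp: mat_lim_def carrier_matD[of _ n m] intro!: tendsto_add)

lemma mat_lim_minus:
  assumes "mat_lim n m F A l" "mat_lim n m G B l"
  shows "mat_lim n m (\<lambda>z. F z - G z) (A - B) l"
  using assms by (auto simp: mat_lim_def carrier_matD[of _ n m] intro!: tendsto_diff minus_carrier_mat)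

lemma mat_lim_smult:
  assumes "(f \<longlongrightarrow> c) l" "mat_lim n m F A l"
  shows "mat_lim n m (\<lambda>z. f z \<cdot>\<^sub>m F z) (c \<cdot>\<^sub>m A) l"
  using assms by (auto simp: mat_lim_def carrier_matD[of _ n m] intro!: tendsto_mult)

lemma mat_lim_unique:
  assumes "mat_lim n m F A l" "mat_lim n m G B l" "l \<noteq> bot" "eventually (\<lambda>z. F z = G z) l"
  shows "A = B"
proof (rule eq_matI)
  note c = mat_lim_carrier(1)[OF assms(1)] mat_lim_carrier(1)[OF assms(2)]
  fix i j assume ij: "i < dim_row B" "j < dim_col B"
  have "((\<lambda>z. G z $$ (i, j)) \<longlongrightarrow> A $$ (i, j)) l"
  proof (rule Lim_transform_eventually)
    show "((\<lambda>z. F z $$ (i, j)) \<longlongrightarrow> A $$ (i, j)) l"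
      using assms(1) ij c by (auto simp: mat_lim_def)
    show "eventually (\<lambda>z. F z $$ (i, j) = G z $$ (i, j)) l"
      using assms(4) by eventually_elim simp
  qed
  moreover have "((\<lambda>z. G z $$ (i, j)) \<longlongrightarrow> B $$ (i, j)) l"
    using assms(2) ij c by (auto simp: mat_lim_def)
  ultimately show "A $$ (i, j) = B $$ (i, j)"
    using assms(3) tendsto_unique by blast
qed (use assms in \<open>auto simp: mat_lim_def\<close>)

lemma mat_lim_det:
  assumes "mat_lim n n F A l"
  shows "((\<lambda>z. det (F z)) \<longlongrightarrow> det A) l"
proof -
  note c = mat_lim_carrier[OF assms]
  have "((\<lambda>z. \<Sum>p\<in>{p. p permutes {0..<n}}. signof p * (\<Prod>i\<in>{0..<n}. F z $$ (i, p i)))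
     \<longlongrightarrow> (\<Sum>p\<in>{p. p permutes {0..<n}}. signof p * (\<Prod>i\<in>{0..<n}. A $$ (i, p i)))) l"
    using assms
    by (intro tendsto_sum tendsto_mult tendsto_prod tendsto_const)
      (auto simp: mat_lim_def dest: permutes_in_image)
  then show ?thesis
    by (simp add: det_def'[OF c(1)] det_def'[OF c(2)])
qed

text \<open>The entries of the adjugate \<open>adj_mat\<close> (as opposed to the conjugate
  transpose \<open>adj\<close>) are signed minors, hence polynomial in the entries. This lets the
  adjugate replace an inverse inside a limit.\<close>

lemma mat_lim_adj_mat:
  assumes "mat_lim n n F A l"
  shows "mat_lim n n (\<lambda>z. adj_mat (F z)) (adj_mat A) l"
proof -
  note c = mat_lim_carrier[OF assms]
  have del: "mat_lim (n - 1) (n - 1) (\<lambda>z. mat_delete (F z) j i) (mat_delete A j i) l"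
    if "i < n" "j < n" for i j
    using assms that unfolding mat_lim_def
    by (auto simp: mat_delete_def carrier_matD[of _ n n])
  have "((\<lambda>z. cofactor (F z) j i) \<longlongrightarrow> cofactor A j i) l" if "i < n" "j < n" for i j
    unfolding cofactor_def by (intro tendsto_mult tendsto_const mat_lim_det[OF del] that)
  then show ?thesis
    unfolding mat_lim_def using adj_mat(1)[OF c(1)] adj_mat(1)[OF c(2)] carrier_matD[OF c(1)] carrier_matD[OF c(2)]
    by (simp add: adj_mat_def)
qed

subsection \<open>Ordered products\<close>

fun mprod :: "nat \<Rightarrow> (nat \<Rightarrow> complex mat) \<Rightarrow> nat \<Rightarrow> complex mat" where
  "mprod m F 0 = 1\<^sub>m m"
| "mprod m F (Suc n) = mprod m F n * F n"

fun rprod :: "nat \<Rightarrow> (nat \<Rightarrow> complex mat) \<Rightarrow> nat \<Rightarrow> complex mat" where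
  "rprod m F 0 = 1\<^sub>m m"
| "rprod m F (Suc n) = F n * rprod m F n"

lemma mprod_carrier: "(\<And>i. F i \<in> carrier_mat m m) \<Longrightarrow> mprod m F n \<in> carrier_mat m m"
  by (induction n) (auto intro!: mult_carrier_mat)

lemma rprod_carrier: "(\<And>i. F i \<in> carrier_mat m m) \<Longrightarrow> rprod m F n \<in> carrier_mat m m"
  by (induction n) (auto intro!: mult_carrier_mat)

lemma mprod_cong: "(\<And>i. i < n \<Longrightarrow> F i = G i) \<Longrightarrow> mprod m F n = mprod m G n"
  by (induction n) auto

lemma mprod_add:
  assumes "\<And>i. F i \<in> carrier_mat m m"
  shows "mprod m F (k + n) = mprod m F k * mprod m (\<lambda>i. F (k + i)) n"
proof (induction n)
  case 0
  then show ?case using mprod_carrier[of F m k] assms by simp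
next
  case (Suc n)
  then show ?case
    using assms mprod_carrier[of F m k] mprod_carrier[of "\<lambda>i. F (k + i)" m n]
    by (simp add: assoc_mult_mat[of _ m m _ m _ m])
qed

lemma mprod_Suc_left:
  assumes "\<And>i. F i \<in> carrier_mat m m"
  shows "mprod m F (Suc n) = F 0 * mprod m (\<lambda>i. F (Suc i)) n"
  using mprod_add[of F m 1 n] assms left_mult_one_mat[of "F 0" m m] by simp

lemma mprod_smult:
  assumes "\<And>i. F i \<in> carrier_mat m m"
  shows "mprod m (\<lambda>i. c \<cdot>\<^sub>m F i) n = c ^ n \<cdot>\<^sub>m mprod m F n"
proof (induction n)
  case 0
  then show ?case by (simp add: mat_one_smult)
next
  case (Suc n)
  then show ?case
    using mprod_carrier[of F m n] assms carrier_matD[OF assms]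
    by (simp add: mat_smult_mult_dim mat_mult_smult_dim mat_smult_smult mult.commute)
qed

text \<open>The orders are opposite, so \<open>G 0\<close> meets \<open>F 0\<close> in the middle
  and the pairs cancel from the inside out, each leaving a scalar \<open>z\<close>.\<close>

lemma rprod_mprod:
  assumes F: "\<And>i. F i \<in> carrier_mat m m" and G: "\<And>i. G i \<in> carrier_mat m m"
    and GF: "\<And>i. G i * F i = z \<cdot>\<^sub>m 1\<^sub>m m"
  shows "rprod m G n * mprod m F n = z ^ n \<cdot>\<^sub>m 1\<^sub>m m"
proof (induction n)
  case 0
  then show ?case by (simp add: mat_one_smult)
next
  case (Suc n)
  note c = carrier_matD[OF F] carrier_matD[OF G] carrier_matD[OF mprod_carrier[OF F]]
    carrier_matD[OF rprod_carrier[OF G]]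
  have "rprod m G (Suc n) * mprod m F (Suc n) = G n * ((rprod m G n * mprod m F n) * F n)"
    by (simp add: mat_assoc_dim c)
  also have "\<dots> = z ^ n \<cdot>\<^sub>m (G n * F n)"
    unfolding Suc.IH by (simp add: c mat_smult_mult_dim mat_mult_smult_dim)
  finally show ?case unfolding GF by (simp add: mat_smult_smult mult.commute)
qed

lemma mat_lim_mprod:
  assumes "\<And>i. mat_lim m m (F i) (A i) l"
  shows "mat_lim m m (\<lambda>z. mprod m (\<lambda>i. F i z) n) (mprod m A n) l"
  by (induction n) (auto intro: mat_lim_mult[OF _ assms] mat_lim_const)

lemma mat_lim_rprod:
  assumes "\<And>i. mat_lim m m (F i) (A i) l"
  shows "mat_lim m m (\<lambda>z. rprod m (\<lambda>i. F i z) n) (rprod m A n) l"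
  by (induction n) (auto intro: mat_lim_mult[OF assms] mat_lim_const)

subsection \<open>Blaschke-Potapov factors\<close>

text \<open>The factor acts as \<open>z\<close> on the range of the projection and as the identity
  on its kernel.\<close>

definition bp_fac :: "nat \<Rightarrow> complex mat \<Rightarrow> complex \<Rightarrow> complex mat" where
  "bp_fac p B z = 1\<^sub>m (2 * p) + (z - 1) \<cdot>\<^sub>m jproj p B"

text \<open>This is \<open>z\<close> times the inverse of \<open>bp_fac p B z\<close> for
  \<open>z \<noteq> 0\<close>, in a polynomial form that remains defined and continuous at
  \<open>z = 0\<close>.\<close>

definition bp_fac_adjugate :: "nat \<Rightarrow> complex mat \<Rightarrow> complex \<Rightarrow> complex mat" where
  "bp_fac_adjugate p B z = z \<cdot>\<^sub>m 1\<^sub>m (2 * p) + (1 - z) \<cdot>\<^sub>m jproj p B"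

lemma bp_fac_carrier:
  assumes "jnormal p B"
  shows "bp_fac p B z \<in> carrier_mat (2 * p) (2 * p)"
    "bp_fac_adjugate p B z \<in> carrier_mat (2 * p) (2 * p)"
  using dim_jproj[OF assms] by (auto simp: bp_fac_def bp_fac_adjugate_def)

lemma bp_fac_zero: "jnormal p B \<Longrightarrow> bp_fac p B 0 = 1\<^sub>m (2 * p) - jproj p B"
  using dim_jproj[of p B] by (auto simp: bp_fac_def intro!: eq_matI)

lemma bp_fac_adjugate_mult:
  assumes "jnormal p B"
  shows "bp_fac_adjugate p B z * bp_fac p B z = z \<cdot>\<^sub>m 1\<^sub>m (2 * p)"
  using dim_jproj[OF assms] unfolding bp_fac_def bp_fac_adjugate_def
  by (simp add: mat_dim_simps jproj_idem[OF assms])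
    (auto intro!: eq_matI simp: algebra_simps)

lemma mat_lim_bp_fac:
  assumes "jnormal p B"
  shows "mat_lim (2 * p) (2 * p) (bp_fac p B) (bp_fac p B a) (at a)"
    "mat_lim (2 * p) (2 * p) (bp_fac_adjugate p B) (bp_fac_adjugate p B a) (at a)"
  unfolding bp_fac_def[abs_def] bp_fac_adjugate_def[abs_def]
  using dim_jproj[OF assms]
  by (auto intro!: mat_lim_add mat_lim_smult mat_lim_const tendsto_intros)

text \<open>Induction strips the rightmost factor, which acts first: \<open>I - P\<close> is
  injective on j-nonpositive vectors and returns a j-nonpositive vector, to which the hypothesis
  applies.\<close>

lemma mprod_compl_inj:
  assumes B: "\<And>i. jnormal p (B i)" and x: "dim_vec x = 2 * p" "jform p x \<le> 0"
    and z: "mprod (2 * p) (\<lambda>i. bp_fac p (B i) 0) n *\<^sub>v x = 0\<^sub>v (2 * p)"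
  shows "x = 0\<^sub>v (2 * p)"
  using x z
proof (induction n arbitrary: x)
  case 0
  then show ?case by (simp add: one_mult_mat_vec[OF carrier_vecI])
next
  case (Suc n)
  note d = carrier_matD[OF bp_fac_carrier(1)[OF B]]
    carrier_matD[OF mprod_carrier[of "\<lambda>i. bp_fac p (B i) 0", OF bp_fac_carrier(1)[OF B]]]
  let ?y = "bp_fac p (B n) 0 *\<^sub>v x"
  have "jform p ?y \<le> 0"
    unfolding bp_fac_zero[OF B] using Suc.prems by (intro jproj_compl_nonpos B)
  moreover have "mprod (2 * p) (\<lambda>i. bp_fac p (B i) 0) n *\<^sub>v ?y = 0\<^sub>v (2 * p)"
    using Suc.prems d by (simp add: mat_vec_assoc_dim)
  ultimately have "?y = 0\<^sub>v (2 * p)"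
    using Suc.IH[of ?y] d by simp
  then show ?case
    using jproj_compl_inj[OF B Suc.prems(1,2)] unfolding bp_fac_zero[OF B] by simp
qed

text \<open>The columns of \<open>G\<close> form a basis of a \<open>p\<close>-dimensional
  j-nonpositive subspace.\<close>

definition jneg_frame :: "nat \<Rightarrow> complex mat \<Rightarrow> bool" where
  "jneg_frame p G \<longleftrightarrow> G \<in> carrier_mat (2 * p) p \<and> inj_mat G \<and>
     (\<forall>v. dim_vec v = p \<longrightarrow> jform p (G *\<^sub>v v) \<le> 0)"

lemma mprod_frame_inj:
  assumes B: "\<And>i. jnormal p (B i)" and G: "jneg_frame p G"
  shows "inj_mat (mprod (2 * p) (\<lambda>i. bp_fac p (B i) 0) n * G)"
  unfolding inj_mat_def
proof (intro allI impI)
  fix v :: "complex vec"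
  let ?M = "mprod (2 * p) (\<lambda>i. bp_fac p (B i) 0) n"
  note d = carrier_matD[OF mprod_carrier[of "\<lambda>i. bp_fac p (B i) 0", OF bp_fac_carrier(1)[OF B]]]
  assume "dim_vec v = dim_col (?M * G)" "?M * G *\<^sub>v v = 0\<^sub>v (dim_row (?M * G))"
  then have v: "dim_vec v = p" "?M *\<^sub>v (G *\<^sub>v v) = 0\<^sub>v (2 * p)"
    using G d by (auto simp: jneg_frame_def mat_vec_assoc_dim)
  then have "G *\<^sub>v v = 0\<^sub>v (2 * p)"
    using G by (intro mprod_compl_inj[OF B _ _ v(2)]) (auto simp: jneg_frame_def)
  then show "v = 0\<^sub>v (dim_col (?M * G))"
    using G v unfolding jneg_frame_def inj_mat_def by auto
qed

subsection \<open>Peeling off the factors\<close>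

text \<open>In the limit the product at \<open>0\<close> times \<open>G0\<close> equals
  \<open>Y0 * M0\<close>. The left side is injective by \<open>mprod_frame_inj\<close>, and so is
  the right factor \<open>M0\<close>.\<close>

lemma frame_multiplier_det:
  assumes B: "\<And>i. jnormal p (B i)"
    and G: "mat_lim (2 * p) p G G0 (at 0)" and G0: "jneg_frame p G0"
    and M: "mat_lim p p M M0 (at 0)" and Y: "mat_lim (2 * p) p Y Y0 (at 0)"
    and eq: "\<forall>\<^sub>F z in at 0. mprod (2 * p) (\<lambda>i. bp_fac p (B i) z) n * G z = Y z * M z"
  shows "det M0 \<noteq> 0"
proof -
  have "mat_lim (2 * p) p (\<lambda>z. mprod (2 * p) (\<lambda>i. bp_fac p (B i) z) n * G z)
      (mprod (2 * p) (\<lambda>i. bp_fac p (B i) 0) n * G0) (at 0)"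
    by (intro mat_lim_mult[OF mat_lim_mprod G] mat_lim_bp_fac B)
  moreover have "mat_lim (2 * p) p (\<lambda>z. Y z * M z) (Y0 * M0) (at 0)"
    by (rule mat_lim_mult[OF Y M])
  ultimately have "mprod (2 * p) (\<lambda>i. bp_fac p (B i) 0) n * G0 = Y0 * M0"
    using eq by (intro mat_lim_unique) auto
  then have "inj_mat (Y0 * M0)"
    using mprod_frame_inj[of p B G0 n] B G0 by simp
  then have "inj_mat M0"
    using mat_lim_carrier(1)[OF Y] mat_lim_carrier(1)[OF M] by (intro inj_mat_factor[of Y0 M0]) auto
  then show ?thesis
    by (rule inj_mat_det[OF mat_lim_carrier(1)[OF M]])
qed

text \<open>Stripping the common first \<open>k\<close> factors leaves tails \<open>Xt\<close>,
  \<open>Xh\<close> with \<open>det (Mh) Xt - Xh adj_mat (Mh) Mt\<close> tending to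
  \<open>0\<close>. In the limit the columns of \<open>Xt0\<close> lie in the span of those of
  \<open>Xh0\<close>, so both projections of index \<open>k\<close> annihilate the injective matrix
  \<open>Xt0\<close>.\<close>

lemma jproj_step:
  assumes Bt: "\<And>i. jnormal p (Bt i)" and Bh: "\<And>i. jnormal p (Bh i)"
    and Gt: "mat_lim (2 * p) p Gt Gt0 (at 0)" and Gt0: "jneg_frame p Gt0"
    and Gh: "mat_lim (2 * p) p Gh Gh0 (at 0)" and Gh0: "jneg_frame p Gh0"
    and Mt: "mat_lim p p Mt Mt0 (at 0)" and Mh: "mat_lim p p Mh Mh0 (at 0)"
    and Yt: "\<And>z. Yt z \<in> carrier_mat (2 * p) p" and Yh: "mat_lim (2 * p) p Yh Yh0 (at 0)"
    and eqt: "\<forall>\<^sub>F z in at 0. mprod (2 * p) (\<lambda>i. bp_fac p (Bt i) z) (k + Suc nt) * Gt z = Yt z * Mt z"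
    and eqh: "\<forall>\<^sub>F z in at 0. mprod (2 * p) (\<lambda>i. bp_fac p (Bh i) z) (k + Suc nh) * Gh z = Yh z * Mh z"
    and D: "mat_lim (2 * p) p (\<lambda>z. (1 / z ^ k) \<cdot>\<^sub>m (Yt z - Yh z)) (0\<^sub>m (2 * p) p) (at 0)"
    and same: "\<And>i. i < k \<Longrightarrow> jproj p (Bt i) = jproj p (Bh i)"
  shows "jproj p (Bt k) = jproj p (Bh k)"
proof -
  define m where "m = 2 * p"
  \<comment> \<open>The tail starts with the factor of index \<open>k\<close>; the length
    \<open>Suc nt\<close> ensures that this factor is present.\<close>
  define Xt where "Xt z = mprod m (\<lambda>i. bp_fac p (Bt (k + i)) z) (Suc nt) * Gt z" for z
  define Xh where "Xh z = mprod m (\<lambda>i. bp_fac p (Bh (k + i)) z) (Suc nh) * Gh z" for z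
  define Xt0 where "Xt0 = mprod m (\<lambda>i. bp_fac p (Bt (k + i)) 0) (Suc nt) * Gt0"
  define Xh0 where "Xh0 = mprod m (\<lambda>i. bp_fac p (Bh (k + i)) 0) (Suc nh) * Gh0"
  define E where "E z = mprod m (\<lambda>i. bp_fac p (Bh i) z) k" for z
  define E' where "E' z = rprod m (\<lambda>i. bp_fac_adjugate p (Bh i) z) k" for z
  define S where "S z = (1 / z ^ k) \<cdot>\<^sub>m (Yt z - Yh z)" for z
  have limXt: "mat_lim m p Xt Xt0 (at 0)"
    unfolding Xt_def[abs_def] Xt0_def m_def by (intro mat_lim_mult[OF mat_lim_mprod Gt] mat_lim_bp_fac Bt)
  have limXh: "mat_lim m p Xh Xh0 (at 0)"
    unfolding Xh_def[abs_def] Xh0_def m_def by (intro mat_lim_mult[OF mat_lim_mprod Gh] mat_lim_bp_fac Bh)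
  have limE': "mat_lim m m E' (E' 0) (at 0)"
    unfolding E'_def[abs_def] m_def by (intro mat_lim_rprod mat_lim_bp_fac Bh)
  have E: "E z \<in> carrier_mat m m" for z
    unfolding E_def m_def by (intro mprod_carrier bp_fac_carrier Bh)
  \<comment> \<open>A factor depends on its row only through the projection, so the two systems
    share the head \<open>E\<close>.\<close>
  have E't: "mprod m (\<lambda>i. bp_fac p (Bt i) z) k = E z" for z
    unfolding E_def by (rule mprod_cong) (simp add: bp_fac_def same)
  have E'E: "E' z * E z = z ^ k \<cdot>\<^sub>m 1\<^sub>m m" for z
    unfolding E_def E'_def m_def
    by (intro rprod_mprod bp_fac_carrier bp_fac_adjugate_mult Bh)
  note c = carrier_matD[OF mat_lim_carrier(2)[OF limXt]] carrier_matD[OF mat_lim_carrier(2)[OF limXh]]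
    carrier_matD[OF mat_lim_carrier(2)[OF limE']] carrier_matD[OF E]
    carrier_matD[OF mat_lim_carrier(2)[OF Mt]] carrier_matD[OF mat_lim_carrier(2)[OF Mh]]
    carrier_matD[OF Yt, folded m_def] carrier_matD[OF mat_lim_carrier(2)[OF Yh], folded m_def]
    carrier_matD[OF adj_mat(1)[OF mat_lim_carrier(2)[OF Mh]]]
  have et: "\<forall>\<^sub>F z in at 0. E z * Xt z = Yt z * Mt z"
    using eqt
  proof eventually_elim
    case (elim z)
    then show ?case
      using mprod_add[of "\<lambda>i. bp_fac p (Bt i) z" m k "Suc nt"] bp_fac_carrier(1)[OF Bt, folded m_def]
        mprod_carrier[of "\<lambda>i. bp_fac p (Bt (k + i)) z" m "Suc nt"] E[of z] mat_lim_carrier(2)[OF Gt, folded m_def, of z]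
      unfolding Xt_def m_def[symmetric] by (simp add: E't del: mprod.simps)
  qed
  have eh: "\<forall>\<^sub>F z in at 0. E z * Xh z = Yh z * Mh z"
    using eqh
  proof eventually_elim
    case (elim z)
    then show ?case
      using mprod_add[of "\<lambda>i. bp_fac p (Bh i) z" m k "Suc nh"] bp_fac_carrier(1)[OF Bh, folded m_def]
        mprod_carrier[of "\<lambda>i. bp_fac p (Bh (k + i)) z" m "Suc nh"] E[of z] mat_lim_carrier(2)[OF Gh, folded m_def, of z]
      unfolding Xh_def m_def[symmetric] by (simp add: E_def[symmetric] del: mprod.simps)
  qed
  have "\<forall>\<^sub>F z in at 0. det (Mh z) \<cdot>\<^sub>m Xt z - Xh z * (adj_mat (Mh z) * Mt z)
      = det (Mh z) \<cdot>\<^sub>m (E' z * (S z * Mt z))"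
    \<comment> \<open>Multiplying by \<open>E'\<close> replaces \<open>E\<close> by the scalar
      \<open>z ^ k\<close>. The adjugate of \<open>Mh\<close> brings both equations to the common
      right factor \<open>Mt\<close> without inverting \<open>Mh z\<close>, and
      \<open>z \<noteq> 0\<close> permits division by \<open>z ^ k\<close>.\<close>
    using et eh eventually_neq_at_within[of 0 0 UNIV]
  proof eventually_elim
    case (elim z)
    let ?d = "det (Mh z)" and ?A = "adj_mat (Mh z)"
    have "z ^ k \<cdot>\<^sub>m Xt z = E' z * (Yt z * Mt z)"
      using mat_assoc_dim[of "E' z" "E z" "Xt z"] by (simp add: E'E elim(1)[symmetric] c mat_smult_mult_dim)
    moreover have "z ^ k \<cdot>\<^sub>m (Xh z * (?A * Mt z)) = E' z * (Yh z * (?d \<cdot>\<^sub>m Mt z))"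
    proof -
      have "z ^ k \<cdot>\<^sub>m (Xh z * (?A * Mt z)) = E' z * E z * Xh z * (?A * Mt z)"
        by (simp add: E'E c mat_smult_mult_dim)
      also have "\<dots> = E' z * ((E z * Xh z) * (?A * Mt z))"
        by (simp add: c mat_assoc_dim)
      also have "\<dots> = E' z * (Yh z * ((Mh z * ?A) * Mt z))"
        unfolding elim(2) by (simp add: c mat_assoc_dim)
      also have "(Mh z * ?A) * Mt z = ?d \<cdot>\<^sub>m Mt z"
        unfolding adj_mat(2)[OF mat_lim_carrier(2)[OF Mh]] by (simp add: c mat_smult_mult_dim)
      finally show ?thesis .
    qed
    moreover have "z ^ k \<cdot>\<^sub>m (E' z * (S z * Mt z)) = E' z * (Yt z * Mt z) - E' z * (Yh z * Mt z)"
      unfolding S_def using elim(3)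
      by (simp add: c mat_dim_simps mat_smult_smult mat_one_smult)
    ultimately have e: "z ^ k \<cdot>\<^sub>m (?d \<cdot>\<^sub>m Xt z - Xh z * (?A * Mt z))
        = z ^ k \<cdot>\<^sub>m (?d \<cdot>\<^sub>m (E' z * (S z * Mt z)))"
    proof -
      assume 1: "z ^ k \<cdot>\<^sub>m Xt z = E' z * (Yt z * Mt z)"
        and 2: "z ^ k \<cdot>\<^sub>m (Xh z * (?A * Mt z)) = E' z * (Yh z * (?d \<cdot>\<^sub>m Mt z))"
        and 3: "z ^ k \<cdot>\<^sub>m (E' z * (S z * Mt z)) = E' z * (Yt z * Mt z) - E' z * (Yh z * Mt z)"
      have "z ^ k \<cdot>\<^sub>m (?d \<cdot>\<^sub>m Xt z - Xh z * (?A * Mt z))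
          = ?d \<cdot>\<^sub>m (z ^ k \<cdot>\<^sub>m Xt z) - z ^ k \<cdot>\<^sub>m (Xh z * (?A * Mt z))"
        by (rule eq_matI) (auto simp: c algebra_simps)
      also have "\<dots> = ?d \<cdot>\<^sub>m (E' z * (Yt z * Mt z) - E' z * (Yh z * Mt z))"
        unfolding 1 2 by (rule eq_matI) (auto simp: c mat_mult_smult_dim algebra_simps)
      also have "\<dots> = z ^ k \<cdot>\<^sub>m (?d \<cdot>\<^sub>m (E' z * (S z * Mt z)))"
        unfolding 3[symmetric] by (simp add: mat_smult_smult mult.commute)
      finally show ?thesis .
    qed
    have "(1 / z ^ k) \<cdot>\<^sub>m (z ^ k \<cdot>\<^sub>m (?d \<cdot>\<^sub>m Xt z - Xh z * (?A * Mt z)))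
        = (1 / z ^ k) \<cdot>\<^sub>m (z ^ k \<cdot>\<^sub>m (?d \<cdot>\<^sub>m (E' z * (S z * Mt z))))"
      unfolding e ..
    then show ?case
      using elim(3) by (simp add: mat_smult_smult mat_one_smult)
  qed
  moreover have "mat_lim m p (\<lambda>z. det (Mh z) \<cdot>\<^sub>m Xt z - Xh z * (adj_mat (Mh z) * Mt z))
      (det Mh0 \<cdot>\<^sub>m Xt0 - Xh0 * (adj_mat Mh0 * Mt0)) (at 0)"
    by (intro mat_lim_minus mat_lim_smult mat_lim_det[OF Mh] limXt mat_lim_mult[OF limXh]
        mat_lim_mult[OF mat_lim_adj_mat[OF Mh] Mt])
  moreover have "mat_lim m p (\<lambda>z. det (Mh z) \<cdot>\<^sub>m (E' z * (S z * Mt z)))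
      (det Mh0 \<cdot>\<^sub>m (E' 0 * (0\<^sub>m m p * Mt0))) (at 0)"
    using D[folded S_def m_def]
    by (intro mat_lim_smult mat_lim_det[OF Mh] mat_lim_mult[OF limE'] mat_lim_mult[OF _ Mt])
  ultimately have "det Mh0 \<cdot>\<^sub>m Xt0 - Xh0 * (adj_mat Mh0 * Mt0) = det Mh0 \<cdot>\<^sub>m (E' 0 * (0\<^sub>m m p * Mt0))"
    by (intro mat_lim_unique) auto
  also have "\<dots> = 0\<^sub>m m p"
    using mat_lim_carrier(1)[OF limE'] mat_lim_carrier(1)[OF Mt] by (auto intro!: eq_matI)
  finally have lim: "det Mh0 \<cdot>\<^sub>m Xt0 = Xh0 * (adj_mat Mh0 * Mt0)"
    by (rule mat_minus_eq_zero)
      (use mat_lim_carrier(1)[OF limXt] mat_lim_carrier(1)[OF limXh] mat_lim_carrier(1)[OF Mt] in simp_all)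
  have det: "det Mh0 \<noteq> 0"
    by (rule frame_multiplier_det[where B = Bh, OF Bh Gh Gh0 Mh Yh eqh])
  \<comment> \<open>At \<open>z = 0\<close> the leftmost factor of the tail is \<open>I - P\<close>
    with \<open>P = jproj p (B k)\<close>, and \<open>P (I - P) = 0\<close>.\<close>
  have ker: "jproj p (B k) * (mprod m (\<lambda>i. bp_fac p (B (k + i)) 0) (Suc n) * G) = 0\<^sub>m m p"
    if B: "\<And>i. jnormal p (B i)" and G: "G \<in> carrier_mat m p" for B n G
  proof -
    let ?R = "mprod m (\<lambda>i. bp_fac p (B (k + Suc i)) 0) n"
    have R: "?R \<in> carrier_mat m m"
      unfolding m_def by (intro mprod_carrier bp_fac_carrier B)
    have "mprod m (\<lambda>i. bp_fac p (B (k + i)) 0) (Suc n) = bp_fac p (B k) 0 * ?R"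
      using mprod_Suc_left[of "\<lambda>i. bp_fac p (B (k + i)) 0" m n] bp_fac_carrier(1)[OF B]
      by (simp add: m_def del: mprod.simps)
    then have "jproj p (B k) * (mprod m (\<lambda>i. bp_fac p (B (k + i)) 0) (Suc n) * G)
        = jproj p (B k) * bp_fac p (B k) 0 * (?R * G)"
      using R G dim_jproj[OF B] carrier_matD[OF bp_fac_carrier(1)[OF B]]
      by (simp add: mat_assoc_dim m_def del: mprod.simps)
    also have "jproj p (B k) * bp_fac p (B k) 0 = 0\<^sub>m m m"
      unfolding bp_fac_zero[OF B] m_def
      by (simp add: mat_mult_minus_dim dim_jproj[OF B] jproj_idem[OF B] minus_r_inv_mat[OF carrier_matI])
    finally show ?thesis using R G by simp
  qed
  have kt: "jproj p (Bt k) * Xt0 = 0\<^sub>m m p" and kh: "jproj p (Bh k) * Xh0 = 0\<^sub>m m p"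
    unfolding Xt0_def Xh0_def
    using ker[OF Bt] ker[OF Bh] mat_lim_carrier(1)[OF Gt] mat_lim_carrier(1)[OF Gh] by (simp_all add: m_def)
  \<comment> \<open>The kernel relation for \<open>Xh0\<close> is carried over to \<open>Xt0\<close>
    through the limit identity; the scalar \<open>det Mh0\<close> is nonzero and cancels.\<close>
  have "det Mh0 \<cdot>\<^sub>m (jproj p (Bh k) * Xt0) = jproj p (Bh k) * (det Mh0 \<cdot>\<^sub>m Xt0)"
    using mat_lim_carrier(1)[OF limXt] by (simp add: mat_mult_smult_dim dim_jproj[OF Bh] m_def)
  also have "\<dots> = jproj p (Bh k) * Xh0 * (adj_mat Mh0 * Mt0)"
    unfolding lim using mat_lim_carrier(1)[OF limXh] mat_lim_carrier(1)[OF Mt]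
      adj_mat(1)[OF mat_lim_carrier(1)[OF Mh]]
    by (simp add: mat_assoc_dim dim_jproj[OF Bh] m_def)
  also have "\<dots> = 0\<^sub>m m p"
    unfolding kh using mat_lim_carrier(1)[OF Mt] adj_mat(1)[OF mat_lim_carrier(1)[OF Mh]] by simp
  finally have "(1 / det Mh0) \<cdot>\<^sub>m (det Mh0 \<cdot>\<^sub>m (jproj p (Bh k) * Xt0)) = (1 / det Mh0) \<cdot>\<^sub>m 0\<^sub>m m p"
    by simp
  then have kht: "jproj p (Bh k) * Xt0 = 0\<^sub>m m p"
    using det by (simp add: mat_smult_smult mat_one_smult)
  have "inj_mat Xt0"
    unfolding Xt0_def m_def by (intro mprod_frame_inj Bt Gt0)
  then show ?thesis
    using jproj_kernel_unique[OF Bt Bh] mat_lim_carrier(1)[OF limXt] kt kht by (simp add: m_def)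
qed

text \<open>Strong induction: the step at \<open>k\<close> needs agreement of all earlier
  projections and frames that differ by \<open>o(z ^ k)\<close>.\<close>

lemma jproj_determined:
  assumes Bt: "\<And>i. jnormal p (Bt i)" and Bh: "\<And>i. jnormal p (Bh i)"
    and Gt: "mat_lim (2 * p) p Gt Gt0 (at 0)" "jneg_frame p Gt0"
    and Gh: "mat_lim (2 * p) p Gh Gh0 (at 0)" "jneg_frame p Gh0"
    and Mt: "mat_lim p p Mt Mt0 (at 0)" and Mh: "mat_lim p p Mh Mh0 (at 0)"
    and Yt: "\<And>z. Yt z \<in> carrier_mat (2 * p) p" and Yh: "mat_lim (2 * p) p Yh Yh0 (at 0)"
    and eqt: "\<forall>\<^sub>F z in at 0. mprod (2 * p) (\<lambda>i. bp_fac p (Bt i) z) (Suc Lt) * Gt z = Yt z * Mt z"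
    and eqh: "\<forall>\<^sub>F z in at 0. mprod (2 * p) (\<lambda>i. bp_fac p (Bh i) z) (Suc Lh) * Gh z = Yh z * Mh z"
    and D: "\<And>k. k \<le> N \<Longrightarrow>
      mat_lim (2 * p) p (\<lambda>z. (1 / z ^ k) \<cdot>\<^sub>m (Yt z - Yh z)) (0\<^sub>m (2 * p) p) (at 0)"
    and N: "N \<le> Lt" "N \<le> Lh"
  shows "k \<le> N \<Longrightarrow> jproj p (Bt k) = jproj p (Bh k)"
proof (induction k rule: less_induct)
  case (less k)
  \<comment> \<open>Both full products are split after their first \<open>k\<close> factors, as
    \<open>jproj_step\<close> expects; \<open>k \<le> N\<close> makes the natural subtractions
    exact.\<close>
  have L: "k + Suc (Lt - k) = Suc Lt" "k + Suc (Lh - k) = Suc Lh"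
    using less.prems N by auto
  show ?case
  proof (rule jproj_step[where Bt = Bt and Bh = Bh and nt = "Lt - k" and nh = "Lh - k",
        OF Bt Bh Gt Gh Mt Mh Yt Yh _ _ D[OF less.prems]])
    show "jproj p (Bt i) = jproj p (Bh i)" if "i < k" for i
      using less that by simp
  qed (unfold L, fact eqt, fact eqh)
qed

subsection \<open>The fundamental solution as a Blaschke-Potapov product\<close>

text \<open>Conjugation by \<open>K\<close> carries \<open>j\<close> to \<open>J\<close>, so
  normalisation with respect to \<open>J\<close> becomes normalisation with respect to
  \<open>j\<close>.\<close>

lemma jnormal_Kmat:
  assumes "\<beta> \<in> carrier_mat p (2 * p)" "\<beta> * Jmat p * adj \<beta> = 1\<^sub>m p"
  shows "jnormal p (\<beta> * Kmat p)"
proof -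
  have "\<beta> * Kmat p * jmat p * adj (\<beta> * Kmat p) = \<beta> * (Kmat p * jmat p * adj (Kmat p)) * adj \<beta>"
    using assms(1) by (simp add: adj_mult mat_assoc_dim)
  then show ?thesis
    using assms by (auto simp: jnormal_def Kmat_jmat)
qed

lemma dim_Cof [simp]: "dim_row (Cof p \<beta> k) = 2 * p" "dim_col (Cof p \<beta> k) = 2 * p"
  by (simp_all add: Cof_def)

lemma Cof_eq:
  assumes "\<beta> k \<in> carrier_mat p (2 * p)"
  shows "Cof p \<beta> k = 2 \<cdot>\<^sub>m (adj (\<beta> k * Kmat p) * (\<beta> k * Kmat p)) - jmat p"
  using assms by (simp add: Cof_def adj_mult mat_assoc_dim)

lemma adj_Cof:
  assumes "\<beta> k \<in> carrier_mat p (2 * p)"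
  shows "adj (Cof p \<beta> k) = Cof p \<beta> k"
  using assms by (simp add: Cof_eq[of \<beta> k p] adj_minus adj_smult adj_mult)

lemma Cof_jmat:
  assumes "\<beta> k \<in> carrier_mat p (2 * p)"
  shows "Cof p \<beta> k * jmat p = 2 \<cdot>\<^sub>m jproj p (\<beta> k * Kmat p) - 1\<^sub>m (2 * p)"
  using assms by (simp add: Cof_eq[of \<beta> k p] jproj_def mat_minus_mult_dim mat_smult_mult_dim)

text \<open>\<open>C j = 2 P - I\<close> is determined by the projection, and a second
  multiplication by \<open>j\<close> recovers \<open>C\<close>.\<close>

lemma Cof_eqI:
  assumes "\<beta> k \<in> carrier_mat p (2 * p)" "\<beta>' k \<in> carrier_mat p (2 * p)"
    and "jproj p (\<beta> k * Kmat p) = jproj p (\<beta>' k * Kmat p)"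
  shows "Cof p \<beta> k = Cof p \<beta>' k"
proof -
  have "Cof p \<beta> k * jmat p * jmat p = Cof p \<beta>' k * jmat p * jmat p"
    using assms by (simp add: Cof_jmat)
  then show ?thesis by (simp add: mat_assoc_dim)
qed

lemma dim_Wsol [simp]: "dim_row (Wsol p C l n) = 2 * p" "dim_col (Wsol p C l n) = 2 * p"
  by (induction n) (auto simp: Let_def)

text \<open>The adjoint reverses the order of the factors, so the factor of index \<open>0\<close>
  stands leftmost and can be cancelled first; the conjugated argument makes the factors rational in
  \<open>l\<close>.\<close>

lemma adj_Wsol:
  assumes "\<And>k. jnormal p (\<beta> k * Kmat p)" "\<And>k. \<beta> k \<in> carrier_mat p (2 * p)"
  shows "adj (Wsol p (Cof p \<beta>) (cnj l) n) = mprod (2 * p)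
    (\<lambda>k. (1 - \<i> / l) \<cdot>\<^sub>m 1\<^sub>m (2 * p) + (2 * \<i> / l) \<cdot>\<^sub>m jproj p (\<beta> k * Kmat p)) n"
proof (induction n)
  case 0
  then show ?case by simp
next
  case (Suc n)
  let ?W = "Wsol p (Cof p \<beta>) (cnj l) n" and ?P = "jproj p (\<beta> n * Kmat p)"
  note d = dim_jproj[OF assms(1)]
  have "adj (Wsol p (Cof p \<beta>) (cnj l) (Suc n))
      = adj ?W - cnj (\<i> / cnj l) \<cdot>\<^sub>m (adj ?W * (Cof p \<beta> n * jmat p))"
    by (simp add: adj_minus adj_smult adj_mult adj_Cof assms(2) mat_assoc_dim)
  \<comment> \<open>Since \<open>cnj (\<i> / cnj l) = - \<i> / l\<close>, the new factor is
    \<open>I + (\<i> / l) C j\<close>, where \<open>C j = 2 P - I\<close>.\<close>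
  also have "\<dots> = adj ?W * ((1 - \<i> / l) \<cdot>\<^sub>m 1\<^sub>m (2 * p) + (2 * \<i> / l) \<cdot>\<^sub>m ?P)"
    unfolding Cof_jmat[where \<beta> = \<beta>, OF assms(2)]
    by (simp add: mat_dim_simps d) (auto intro!: eq_matI simp: d algebra_simps)
  finally show ?case unfolding Suc.IH by simp
qed

definition cayley :: "complex \<Rightarrow> complex" where
  "cayley z = \<i> * (z + 1) / (z - 1)"

text \<open>Under the substitution \<open>\<i> / cayley z = (z - 1) / (z + 1)\<close>, so both
  coefficients share the factor \<open>2 / (z + 1)\<close>.\<close>

lemma cayley_factor:
  assumes "z \<noteq> 1" "z \<noteq> -1" "jnormal p B"
  shows "(1 - \<i> / cayley z) \<cdot>\<^sub>m 1\<^sub>m (2 * p) + (2 * \<i> / cayley z) \<cdot>\<^sub>m jproj p B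
    = (2 / (z + 1)) \<cdot>\<^sub>m bp_fac p B z"
proof -
  have "z + 1 \<noteq> 0" using assms(2) by (simp add: add_eq_0_iff2)
  then have 1: "1 - \<i> / cayley z = 2 / (z + 1)" "2 * \<i> / cayley z = 2 / (z + 1) * (z - 1)"
    using assms by (auto simp: cayley_def divide_simps)
  have "c \<cdot>\<^sub>m 1\<^sub>m (2 * p) + (c * (z - 1)) \<cdot>\<^sub>m jproj p B = c \<cdot>\<^sub>m bp_fac p B z" for c
    unfolding bp_fac_def using dim_jproj[OF assms(3)]
    by (intro eq_matI) (auto simp: algebra_simps)
  then show ?thesis unfolding 1 .
qed

lemma calW_eq:
  assumes "\<And>k. jnormal p (\<beta> k * Kmat p)" "\<And>k. \<beta> k \<in> carrier_mat p (2 * p)" "z \<noteq> 1" "z \<noteq> -1"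
  shows "calW p (Cof p \<beta>) L (cayley z) = (2 / (z + 1)) ^ Suc L \<cdot>\<^sub>m
    (Kmat p * mprod (2 * p) (\<lambda>k. bp_fac p (\<beta> k * Kmat p) z) (Suc L))"
proof -
  have "adj (Wsol p (Cof p \<beta>) (cnj (cayley z)) (Suc L)) =
      (2 / (z + 1)) ^ Suc L \<cdot>\<^sub>m mprod (2 * p) (\<lambda>k. bp_fac p (\<beta> k * Kmat p) z) (Suc L)"
    unfolding adj_Wsol[OF assms(1,2)] cayley_factor[OF assms(3,4,1)]
    by (intro mprod_smult bp_fac_carrier assms)
  moreover have "mprod (2 * p) (\<lambda>k. bp_fac p (\<beta> k * Kmat p) z) (Suc L) \<in> carrier_mat (2 * p) (2 * p)"
    by (intro mprod_carrier bp_fac_carrier assms)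
  ultimately show ?thesis
    unfolding calW_def by (simp add: mat_mult_smult_dim del: mprod.simps Wsol.simps)
qed

subsection \<open>Stacked matrices\<close>

definition stack :: "nat \<Rightarrow> complex mat \<Rightarrow> complex mat \<Rightarrow> complex mat" where
  "stack p R Q = mat (2 * p) p (\<lambda>(i, j). if i < p then R $$ (i, j) else Q $$ (i - p, j))"

lemma stack_carrier [simp]: "stack p R Q \<in> carrier_mat (2 * p) p"
  by (simp add: stack_def)

lemma dim_stack [simp]: "dim_row (stack p R Q) = 2 * p" "dim_col (stack p R Q) = p"
  by (simp_all add: stack_def)

lemma mat_lim_stack:
  assumes "\<And>a b. a < p \<Longrightarrow> b < p \<Longrightarrow> ((\<lambda>z. R z $$ (a, b)) \<longlongrightarrow> R0 $$ (a, b)) l"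
    and "\<And>a b. a < p \<Longrightarrow> b < p \<Longrightarrow> ((\<lambda>z. Q z $$ (a, b)) \<longlongrightarrow> Q0 $$ (a, b)) l"
  shows "mat_lim (2 * p) p (\<lambda>z. stack p (R z) (Q z)) (stack p R0 Q0) l"
  using assms by (auto simp: mat_lim_def stack_def)

lemma mult_stack:
  assumes "V \<in> carrier_mat (2 * p) (2 * p)" "R \<in> carrier_mat p p" "Q \<in> carrier_mat p p"
  shows "V * stack p R Q = stack p (blk p 0 0 V * R + blk p 0 1 V * Q) (blk p 1 0 V * R + blk p 1 1 V * Q)"
proof (rule eq_matI)
  fix i j
  assume "i < dim_row (stack p (blk p 0 0 V * R + blk p 0 1 V * Q) (blk p 1 0 V * R + blk p 1 1 V * Q))"
    "j < dim_col (stack p (blk p 0 0 V * R + blk p 0 1 V * Q) (blk p 1 0 V * R + blk p 1 1 V * Q))"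
  then have ij: "i < 2 * p" "j < p" by simp_all
  have "(V * stack p R Q) $$ (i, j) = (\<Sum>x\<in>{0..<2*p}. V $$ (i, x) * stack p R Q $$ (x, j))"
    using assms ij by (simp add: scalar_prod_def)
  also have "\<dots> = (\<Sum>x\<in>{0..<p}. V $$ (i, x) * R $$ (x, j)) + (\<Sum>x\<in>{0..<p}. V $$ (i, p + x) * Q $$ (x, j))"
    using ij by (simp add: sum_two_blocks stack_def)
  also have "\<dots> = stack p (blk p 0 0 V * R + blk p 0 1 V * Q) (blk p 1 0 V * R + blk p 1 1 V * Q) $$ (i, j)"
    using assms ij by (auto simp: stack_def blk_def scalar_prod_def)
  finally show "(V * stack p R Q) $$ (i, j) = \<dots>" .
qed (use assms in auto)

lemma stack_mult:
  assumes "M \<in> carrier_mat p p" "X \<in> carrier_mat p p"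
  shows "stack p (1\<^sub>m p) X * M = stack p M (X * M)"
proof (rule eq_matI)
  fix i j
  assume "i < dim_row (stack p M (X * M))" "j < dim_col (stack p M (X * M))"
  then have ij: "i < 2 * p" "j < p" by simp_all
  have "(stack p (1\<^sub>m p) X * M) $$ (i, j) = (\<Sum>x\<in>{0..<p}. stack p (1\<^sub>m p) X $$ (i, x) * M $$ (x, j))"
    using assms ij by (simp add: scalar_prod_def)
  also have "\<dots> = stack p M (X * M) $$ (i, j)"
    using assms ij
    by (auto simp: stack_def scalar_prod_def if_distrib[of "\<lambda>c. c * _"] cong: if_cong)
  finally show "(stack p (1\<^sub>m p) X * M) $$ (i, j) = stack p M (X * M) $$ (i, j)" .
qed (use assms in auto)

lemma top_mat_stack:
  assumes "M \<in> carrier_mat p p"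
  shows "top_mat p * stack p M X = M"
proof (rule eq_matI)
  fix i j assume "i < dim_row M" "j < dim_col M"
  then have ij: "i < p" "j < p" using assms by auto
  then have "(top_mat p * stack p M X) $$ (i, j) = (top_mat p *\<^sub>v col (stack p M X) j) $ i"
    by simp
  also have "\<dots> = M $$ (i, j)"
    using ij by (subst top_mat_vec_index) (auto simp: stack_def)
  finally show "(top_mat p * stack p M X) $$ (i, j) = M $$ (i, j)" .
qed (use assms in auto)

lemma stack_vec_index:
  assumes "R \<in> carrier_mat p p" "Q \<in> carrier_mat p p" "dim_vec v = p" "i < p"
  shows "(stack p R Q *\<^sub>v v) $ i = (R *\<^sub>v v) $ i" "(stack p R Q *\<^sub>v v) $ (p + i) = (Q *\<^sub>v v) $ i"
  using assms by (auto simp: stack_def scalar_prod_def)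

lemma jform_stack:
  assumes "R \<in> carrier_mat p p" "Q \<in> carrier_mat p p" "dim_vec v = p"
  shows "jform p (stack p R Q *\<^sub>v v) = Re ((R *\<^sub>v v) \<bullet>c (R *\<^sub>v v)) - Re ((Q *\<^sub>v v) \<bullet>c (Q *\<^sub>v v))"
  using assms
  by (simp add: jform_eq stack_vec_index Re_cscalar_self lessThan_atLeast0 del: index_mult_mat_vec)

text \<open>Links the form \<open>qform\<close>, which takes functions, to squared norms of
  vectors.\<close>

lemma qform_gram:
  assumes "A \<in> carrier_mat p p" "dim_vec v = p"
  shows "qform p (adj A * A) (($) v) = (A *\<^sub>v v) \<bullet>c (A *\<^sub>v v)"
proof -
  have "(A *\<^sub>v v) \<bullet>c (A *\<^sub>v v) = (adj A * A *\<^sub>v v) \<bullet>c v"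
    using assms cscalar_adj[of "adj A" v "A *\<^sub>v v"] by (simp add: mat_vec_assoc_dim)
  also have "\<dots> = (\<Sum>a\<in>{0..<p}. (\<Sum>b\<in>{0..<p}. (adj A * A) $$ (a, b) * v $ b) * cnj (v $ a))"
  proof -
    have "(H *\<^sub>v v) \<bullet>c v = (\<Sum>a\<in>{0..<p}. (\<Sum>b\<in>{0..<p}. H $$ (a, b) * v $ b) * cnj (v $ a))"
      if "H \<in> carrier_mat p p" for H
      using that assms(2) by (simp add: scalar_prod_def)
    from this[of "adj A * A"] show ?thesis using assms(1) by fastforce
  qed
  finally show ?thesis
    by (simp add: qform_def lessThan_atLeast0 sum_distrib_left mult_ac)
qed

lemma qform_add:
  assumes "A \<in> carrier_mat p p" "B \<in> carrier_mat p p"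
  shows "qform p (A + B) v = qform p A v + qform p B v"
  using assms by (simp add: qform_def sum.distrib algebra_simps)

lemma qform_minus:
  assumes "A \<in> carrier_mat p p" "B \<in> carrier_mat p p"
  shows "qform p (A - B) v = qform p A v - qform p B v"
  using assms by (simp add: qform_def sum_subtractf algebra_simps)

text \<open>The semidefinite condition says that \<open>|R v| \<le> |Q v|\<close>, which is
  nonpositivity of the form; a common null vector of \<open>R\<close> and \<open>Q\<close> would
  contradict the definite condition.\<close>

lemma jneg_frame_stack:
  assumes R: "R \<in> carrier_mat p p" and Q: "Q \<in> carrier_mat p p"
    and pos: "posdef_mat p (adj R * R + adj Q * Q)" and psd: "psd_mat p (adj Q * Q - adj R * R)"
  shows "jneg_frame p (stack p R Q)"
proof -
  have RR: "adj R * R \<in> carrier_mat p p" "adj Q * Q \<in> carrier_mat p p"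
    using R Q by auto
  have "jform p (stack p R Q *\<^sub>v v) \<le> 0" if v: "dim_vec v = p" for v
  proof -
    have "0 \<le> Re (qform p (adj Q * Q - adj R * R) (($) v))"
      using psd by (simp add: psd_mat_def)
    then show ?thesis
      using RR R Q v by (simp add: qform_minus qform_gram jform_stack)
  qed
  moreover have "inj_mat (stack p R Q)"
    unfolding inj_mat_def
  proof (intro allI impI, rule ccontr)
    fix v :: "complex vec"
    assume *: "dim_vec v = dim_col (stack p R Q)" "stack p R Q *\<^sub>v v = 0\<^sub>v (dim_row (stack p R Q))"
      and nz: "v \<noteq> 0\<^sub>v (dim_col (stack p R Q))"
    have v: "dim_vec v = p" using * by simp
    have "R *\<^sub>v v = 0\<^sub>v p" "Q *\<^sub>v v = 0\<^sub>v p"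
      using stack_vec_index[OF R Q v] *(2) R Q by (auto intro!: eq_vecI simp del: index_mult_mat_vec)
    then have "Re (qform p (adj R * R + adj Q * Q) (($) v)) = 0"
      using RR R Q v by (simp add: qform_add qform_gram scalar_prod_def)
    moreover have "\<exists>a<p. v $ a \<noteq> 0"
      using nz v by (auto intro!: eq_vecI)
    ultimately show False
      using pos by (auto simp: posdef_mat_def)
  qed
  ultimately show ?thesis by (simp add: jneg_frame_def)
qed

subsection \<open>Weyl functions near the Cayley point\<close>

lemma cayley_0 [simp]: "cayley 0 = - \<i>"
  by (simp add: cayley_def)

lemma cayley_lower_half:
  assumes "cmod z < 1"
  shows "cayley z \<in> lower_half"
proof -
  have "(cmod z)\<^sup>2 < 1" using assms by (simp add: power_less_one_iff)
  \<comment> \<open>This real part equals \<open>|z|\<^sup>2 - 1\<close>.\<close>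
  then have "Re ((z + 1) * cnj (z - 1)) < 0"
    unfolding cmod_power2 by (simp add: algebra_simps power2_eq_square)
  then have "Re ((z + 1) / (z - 1)) < 0"
    by (simp add: Re_complex_div_lt_0)
  then show ?thesis
    by (simp add: cayley_def lower_half_def flip: times_divide_eq_right)
qed

lemma cayley_holomorphic: "cayley holomorphic_on ball 0 1"
  unfolding cayley_def[abs_def] by (intro holomorphic_intros) auto

text \<open>The target filter is punctured because the Weyl identity is available only off a sparse
  set, which may contain \<open>- \<i>\<close> itself.\<close>

lemma cayley_filterlim: "filterlim cayley (at (- \<i>)) (at 0)"
proof -
  have "isCont cayley 0"
    unfolding cayley_def[abs_def] by (intro continuous_intros) auto
  then have "(cayley \<longlongrightarrow> - \<i>) (at 0)"
    by (simp add: isCont_def)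
  moreover have "\<forall>\<^sub>F z in at 0. cayley z \<noteq> - \<i>"
    using eventually_neq_at_within[of 0 0 UNIV] eventually_neq_at_within[of 1 0 UNIV]
  proof eventually_elim
    case (elim z)
    have "cayley z + \<i> = 2 * \<i> * z / (z - 1)"
      using elim by (simp add: cayley_def field_simps)
    moreover have "\<dots> \<noteq> 0" using elim by simp
    ultimately show ?case by (metis ab_group_add_class.ab_left_minus)
  qed
  ultimately show ?thesis by (simp add: filterlim_at)
qed

lemma cayley_tendsto:
  assumes "f analytic_on {- \<i>}"
  shows "((\<lambda>z. f (cayley z)) \<longlongrightarrow> f (- \<i>)) (at 0)"
proof -
  have "isCont f (- \<i>)"
    using assms analytic_at_imp_isCont by blast
  then have "(f \<longlongrightarrow> f (- \<i>)) (at (- \<i>))" by (simp add: isCont_def)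
  then show ?thesis by (rule filterlim_compose[OF _ cayley_filterlim])
qed

text \<open>The lower block is minus the function whose Taylor coefficients are given by
  \<open>taylor_alpha\<close>; \<open>adj (Kmat p)\<close> undoes the factor \<open>K\<close> in
  \<open>calW\<close>.\<close>

definition weyl_frame :: "nat \<Rightarrow> (complex \<Rightarrow> complex mat) \<Rightarrow> complex \<Rightarrow> complex mat" where
  "weyl_frame p \<phi> z =
     adj (Kmat p) * stack p (1\<^sub>m p) (mat p p (\<lambda>(a, b). - (\<i> * \<phi> (cayley z) $$ (a, b))))"

lemma weyl_frame_carrier: "weyl_frame p \<phi> z \<in> carrier_mat (2 * p) p"
  by (auto simp: weyl_frame_def)

text \<open>The Weyl identity reads \<open>W [R; Q] = [I; -i\<phi>] M\<close>, and \<open>W\<close>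
  is a nonzero scalar times \<open>K E\<close> with \<open>K\<close> unitary. Expressing
  \<open>M\<close> as a top block cancels the scalar and leaves a multiplier whose limit at
  \<open>0\<close> follows from those of \<open>E\<close>, \<open>R\<close> and
  \<open>Q\<close>.\<close>

lemma weyl_frame_equation:
  assumes B: "\<And>k. jnormal p (\<beta> k * Kmat p)" "\<And>k. \<beta> k \<in> carrier_mat p (2 * p)" and z: "z \<noteq> 1" "z \<noteq> -1"
    and R: "R \<in> carrier_mat p p" and Q: "Q \<in> carrier_mat p p" and \<phi>: "\<phi> (cayley z) \<in> carrier_mat p p"
    and W: "W = calW p (Cof p \<beta>) L (cayley z)"
    and eq: "\<phi> (cayley z) * (blk p 0 0 W * R + blk p 0 1 W * Q) = \<i> \<cdot>\<^sub>m (blk p 1 0 W * R + blk p 1 1 W * Q)"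
    and E: "E = mprod (2 * p) (\<lambda>k. bp_fac p (\<beta> k * Kmat p) z) (Suc L)"
  shows "E * stack p R Q = weyl_frame p \<phi> z * (top_mat p * (Kmat p * (E * stack p R Q)))"
proof -
  define M where "M = blk p 0 0 W * R + blk p 0 1 W * Q"
  define N where "N = blk p 1 0 W * R + blk p 1 1 W * Q"
  define X where "X = mat p p (\<lambda>(a, b). - (\<i> * \<phi> (cayley z) $$ (a, b)))"
  define c where "c = (2 / (z + 1)) ^ Suc L"
  have "z + 1 \<noteq> 0" using z by (simp add: add_eq_0_iff2)
  then have c: "c \<noteq> 0" by (simp add: c_def)
  have Ec: "E \<in> carrier_mat (2 * p) (2 * p)"
    unfolding E by (intro mprod_carrier bp_fac_carrier B)
  note d = carrier_matD[OF Ec]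
  have W': "W = c \<cdot>\<^sub>m (Kmat p * E)"
    unfolding W E c_def by (rule calW_eq[OF B z])
  have Wc: "W \<in> carrier_mat (2 * p) (2 * p)"
    unfolding W' using Ec by auto
  have Mc: "M \<in> carrier_mat p p" and Nc: "N \<in> carrier_mat p p" and Xc: "X \<in> carrier_mat p p"
    using R Q by (auto simp: M_def N_def X_def blk_def)
  have "X = (- \<i>) \<cdot>\<^sub>m \<phi> (cayley z)"
    using \<phi> by (auto simp: X_def intro!: eq_matI)
  then have "X * M = (- \<i>) \<cdot>\<^sub>m (\<phi> (cayley z) * M)"
    using \<phi> Mc by (simp add: mat_smult_mult_dim)
  also have "\<dots> = N"
    unfolding M_def eq N_def[symmetric] by (simp add: mat_smult_smult mat_one_smult)
  finally have "W * stack p R Q = stack p (1\<^sub>m p) X * M"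
    unfolding mult_stack[OF Wc R Q] stack_mult[OF Mc Xc] by (simp add: M_def N_def)
  then have 1: "c \<cdot>\<^sub>m (Kmat p * (E * stack p R Q)) = stack p (1\<^sub>m p) X * M"
    unfolding W' using d by (simp add: mat_smult_mult_dim mat_assoc_dim)
  then have "top_mat p * (c \<cdot>\<^sub>m (Kmat p * (E * stack p R Q))) = top_mat p * (stack p (1\<^sub>m p) X * M)"
    by simp
  also have "\<dots> = M"
    unfolding stack_mult[OF Mc Xc] by (rule top_mat_stack[OF Mc])
  finally have "M = c \<cdot>\<^sub>m (top_mat p * (Kmat p * (E * stack p R Q)))"
    using d by (simp add: mat_mult_smult_dim)
  then have "c \<cdot>\<^sub>m (Kmat p * (E * stack p R Q))
      = c \<cdot>\<^sub>m (stack p (1\<^sub>m p) X * (top_mat p * (Kmat p * (E * stack p R Q))))"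
    using 1 d by (simp add: mat_mult_smult_dim)
  then have "(1 / c) \<cdot>\<^sub>m (c \<cdot>\<^sub>m (Kmat p * (E * stack p R Q)))
      = (1 / c) \<cdot>\<^sub>m (c \<cdot>\<^sub>m (stack p (1\<^sub>m p) X * (top_mat p * (Kmat p * (E * stack p R Q)))))"
    by simp
  then have "Kmat p * (E * stack p R Q) = stack p (1\<^sub>m p) X * (top_mat p * (Kmat p * (E * stack p R Q)))"
    using c by (simp add: mat_smult_smult mat_one_smult)
  then have "adj (Kmat p) * (Kmat p * (E * stack p R Q))
      = adj (Kmat p) * (stack p (1\<^sub>m p) X * (top_mat p * (Kmat p * (E * stack p R Q))))"
    by simp
  moreover have "adj (Kmat p) * (Kmat p * (E * stack p R Q)) = E * stack p R Q"
    using mat_assoc_dim[of "adj (Kmat p)" "Kmat p" "E * stack p R Q"] d by (simp add: Kmat_unitary)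
  ultimately show ?thesis
    unfolding weyl_frame_def X_def[symmetric] using d by (simp add: mat_assoc_dim)
qed

lemma weyl_function_frame:
  assumes B: "\<And>k. jnormal p (\<beta> k * Kmat p)" "\<And>k. \<beta> k \<in> carrier_mat p (2 * p)"
    and W: "weyl_function p (Cof p \<beta>) L \<phi>"
  obtains G G0 M M0 Y0 where
    "mat_lim (2 * p) p G G0 (at 0)" "jneg_frame p G0" "mat_lim p p M M0 (at 0)"
    "mat_lim (2 * p) p (weyl_frame p \<phi>) Y0 (at 0)"
    "\<forall>\<^sub>F z in at 0. mprod (2 * p) (\<lambda>k. bp_fac p (\<beta> k * Kmat p) z) (Suc L) * G z = weyl_frame p \<phi> z * M z"
proof -
  have mi: "- \<i> \<in> lower_half" "open lower_half"
    by (auto simp: lower_half_def open_halfspace_Im_lt)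
  obtain R Q where RQ: "\<And>z. R z \<in> carrier_mat p p" "\<And>z. Q z \<in> carrier_mat p p"
    and an: "mat_analytic_at p R (- \<i>)" "mat_analytic_at p Q (- \<i>)"
    and pd: "posdef_mat p (adj (R (- \<i>)) * R (- \<i>) + adj (Q (- \<i>)) * Q (- \<i>))"
      "psd_mat p (adj (Q (- \<i>)) * Q (- \<i>) - adj (R (- \<i>)) * R (- \<i>))"
    and ev: "\<forall>\<^sub>\<approx>z\<in>lower_half.
            (let Wz = calW p (Cof p \<beta>) L z;
                 M = blk p 0 0 Wz * R z + blk p 0 1 Wz * Q z;
                 N = blk p 1 0 Wz * R z + blk p 1 1 Wz * Q z
             in invertible_mat M \<and> \<phi> z * M = \<i> \<cdot>\<^sub>m N)"
    \<comment> \<open>The sign conditions hold at every point where \<open>R\<close> and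
      \<open>Q\<close> are both analytic; they are taken at \<open>- \<i>\<close>, the image of
      \<open>z = 0\<close>.\<close>
    using W mi(1) unfolding weyl_function_def by blast
  define G where "G z = stack p (R (cayley z)) (Q (cayley z))" for z
  define G0 where "G0 = stack p (R (- \<i>)) (Q (- \<i>))"
  define E where "E z = mprod (2 * p) (\<lambda>k. bp_fac p (\<beta> k * Kmat p) z) (Suc L)" for z
  have limG: "mat_lim (2 * p) p G G0 (at 0)"
    unfolding G_def[abs_def] G0_def using an
    by (intro mat_lim_stack cayley_tendsto) (auto simp: mat_analytic_at_def)
  have limE: "mat_lim (2 * p) (2 * p) E (E 0) (at 0)"
    unfolding E_def[abs_def] by (intro mat_lim_mprod mat_lim_bp_fac B)
  have limM: "mat_lim p p (\<lambda>z. top_mat p * (Kmat p * (E z * G z))) (top_mat p * (Kmat p * (E 0 * G0))) (at 0)"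
    by (intro mat_lim_mult[OF mat_lim_const mat_lim_mult[OF mat_lim_const mat_lim_mult[OF limE limG]]]
        carrier_matI) auto
  have "(\<lambda>z. \<phi> z $$ (a, b)) analytic_on {- \<i>}" if "a < p" "b < p" for a b
    using W that mi unfolding weyl_function_def by (auto simp: analytic_at)
  then have limY: "mat_lim (2 * p) p (weyl_frame p \<phi>)
      (adj (Kmat p) * stack p (1\<^sub>m p) (mat p p (\<lambda>(a, b). - (\<i> * \<phi> (- \<i>) $$ (a, b))))) (at 0)"
    unfolding weyl_frame_def[abs_def]
    by (intro mat_lim_mult[OF mat_lim_const mat_lim_stack])
      (auto intro!: tendsto_intros cayley_tendsto[where f = "\<lambda>z. \<phi> z $$ (_, _)"])
  have "\<forall>\<^sub>F z in at (- \<i>). (let Wz = calW p (Cof p \<beta>) L z;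
                 M = blk p 0 0 Wz * R z + blk p 0 1 Wz * Q z;
                 N = blk p 1 0 Wz * R z + blk p 1 1 Wz * Q z
             in invertible_mat M \<and> \<phi> z * M = \<i> \<cdot>\<^sub>m N)"
    \<comment> \<open>A cosparse property holds on a punctured neighbourhood of each point of the
      set, here of \<open>- \<i>\<close>.\<close>
    using ev mi(1) by (rule eventually_cosparse_imp_eventually_at)
  moreover have "\<forall>\<^sub>F z in at (- \<i>). \<phi> z \<in> carrier_mat p p"
    using eventually_at_in_open'[OF mi(2,1)] W
    by (auto simp: weyl_function_def elim!: eventually_mono)
  ultimately have "\<forall>\<^sub>F z in at (- \<i>). (let Wz = calW p (Cof p \<beta>) L z
             in \<phi> z * (blk p 0 0 Wz * R z + blk p 0 1 Wz * Q z) =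
               \<i> \<cdot>\<^sub>m (blk p 1 0 Wz * R z + blk p 1 1 Wz * Q z)) \<and> \<phi> z \<in> carrier_mat p p"
    by eventually_elim (simp add: Let_def)
  then have "\<forall>\<^sub>F z in at 0. (let Wz = calW p (Cof p \<beta>) L (cayley z)
             in \<phi> (cayley z) * (blk p 0 0 Wz * R (cayley z) + blk p 0 1 Wz * Q (cayley z)) =
               \<i> \<cdot>\<^sub>m (blk p 1 0 Wz * R (cayley z) + blk p 1 1 Wz * Q (cayley z))) \<and>
             \<phi> (cayley z) \<in> carrier_mat p p"
    using cayley_filterlim by (rule eventually_compose_filterlim)
  moreover have "\<forall>\<^sub>F z in at (0::complex). z \<noteq> 1" "\<forall>\<^sub>F z in at (0::complex). z \<noteq> - 1"
    by (rule eventually_neq_at_within)+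
  ultimately have "\<forall>\<^sub>F z in at 0. E z * G z = weyl_frame p \<phi> z * (top_mat p * (Kmat p * (E z * G z)))"
  proof eventually_elim
    case (elim z)
    then show ?case
      unfolding G_def Let_def
      by (intro weyl_frame_equation[where \<beta> = \<beta> and L = L, OF B _ _ RQ _ refl _ E_def]) auto
  qed
  then show thesis
    using that[OF limG _ limM limY] jneg_frame_stack[OF RQ pd] unfolding E_def G0_def by blast
qed

section \<open>Taylor coefficients and the difference of the frames\<close>

text \<open>Taylor terms through order \<open>k\<close> cancel, so the remainder is
  \<open>O(z ^ Suc k)\<close>, one power more than is divided out.\<close>

lemma higher_deriv_eq_tendsto:
  assumes f: "f holomorphic_on ball 0 1" and g: "g holomorphic_on ball 0 1"
    and eq: "\<And>i. i \<le> k \<Longrightarrow> (deriv ^^ i) f 0 = (deriv ^^ i) g 0"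
  shows "((\<lambda>z. (f z - g z) / z ^ k) \<longlongrightarrow> (0::complex)) (at 0)"
proof -
  define h where "h z = f z - g z" for z
  have h: "h holomorphic_on ball 0 1"
    unfolding h_def[abs_def] by (intro holomorphic_intros f g)
  have h0: "(deriv ^^ i) h 0 = 0" if "i \<le> k" for i
    using higher_deriv_diff[OF f g, of 0 i] eq[OF that] by (simp add: h_def[abs_def])
  let ?S = "cball (0::complex) (1 / 2)"
  have S: "?S \<subseteq> ball 0 1" by auto
  have hol: "(deriv ^^ i) h holomorphic_on ball 0 1" for i
    using h by (rule holomorphic_higher_deriv) auto
  \<comment> \<open>The smaller closed disc supplies a uniform bound on the derivative that controls
    the Taylor remainder.\<close>
  have "compact ((deriv ^^ Suc k) h ` ?S)"
    using holomorphic_on_imp_continuous_on[OF holomorphic_on_subset[OF hol S]]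
    by (intro compact_continuous_image compact_cball)
  then obtain C where C: "\<And>x. x \<in> ?S \<Longrightarrow> cmod ((deriv ^^ Suc k) h x) \<le> C"
    by (meson compact_imp_bounded bounded_iff imageI)
  have bound: "cmod (h z) \<le> C * cmod z ^ Suc k / fact k" if z: "z \<in> ?S" for z
  proof -
    have "cmod ((deriv ^^ 0) h z - (\<Sum>i\<le>k. (deriv ^^ i) h 0 * (z - 0) ^ i / fact i))
        \<le> C * cmod (z - 0) ^ Suc k / fact k"
    proof (rule complex_Taylor[of ?S])
      fix i x assume "x \<in> ?S"
      then have "x \<in> ball 0 1" using S by auto
      then show "((deriv ^^ i) h has_field_derivative (deriv ^^ Suc i) h x) (at x within ?S)"
        using holomorphic_derivI[OF hol, of x i] by (auto intro: has_field_derivative_at_within)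
    qed (use z C in auto)
    then show ?thesis by (simp add: h0)
  qed
  show ?thesis
    unfolding h_def[symmetric]
  proof (rule Lim_null_comparison)
    have "\<forall>\<^sub>F z in at 0. z \<in> ball (0::complex) (1 / 2)"
      by (intro eventually_at_in_open') auto
    then show "\<forall>\<^sub>F z in at 0. cmod (h z / z ^ k) \<le> C * cmod z / fact k"
      using eventually_neq_at_within[of 0 0 UNIV]
    proof eventually_elim
      case (elim z)
      then have "cmod (h z) \<le> C * cmod z ^ Suc k / fact k" by (intro bound) auto
      then show ?case using elim by (simp add: norm_divide norm_power field_simps)
    qed
    show "((\<lambda>z. C * cmod z / fact k) \<longlongrightarrow> 0) (at 0)"
      by (auto intro!: tendsto_eq_intros)
  qed
qed

text \<open>The identity blocks cancel in the difference, leaving only entries to which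
  \<open>higher_deriv_eq_tendsto\<close> applies.\<close>

lemma weyl_frame_diff_tendsto:
  assumes ht: "\<And>a b. a < p \<Longrightarrow> b < p \<Longrightarrow> (\<lambda>z. \<phi>t z $$ (a, b)) holomorphic_on lower_half"
    and hh: "\<And>a b. a < p \<Longrightarrow> b < p \<Longrightarrow> (\<lambda>z. \<phi>h z $$ (a, b)) holomorphic_on lower_half"
    and eq: "\<And>i. i \<le> k \<Longrightarrow> taylor_alpha p \<phi>t i = taylor_alpha p \<phi>h i"
  shows "mat_lim (2 * p) p (\<lambda>z. (1 / z ^ k) \<cdot>\<^sub>m (weyl_frame p \<phi>t z - weyl_frame p \<phi>h z))
    (0\<^sub>m (2 * p) p) (at 0)"
proof -
  let ?f = "\<lambda>\<phi> a b z. \<i> * \<phi> (cayley z) $$ (a, b)"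
  let ?X = "\<lambda>\<phi> z. mat p p (\<lambda>(a, b). - ?f \<phi> a b z)"
  let ?D = "\<lambda>z. mat p p (\<lambda>(a, b). - ((?f \<phi>t a b z - ?f \<phi>h a b z) / z ^ k))"
  have hol: "?f \<phi> a b holomorphic_on ball 0 1"
    if "(\<lambda>z. \<phi> z $$ (a, b)) holomorphic_on lower_half" for \<phi> a b
  proof -
    have "((\<lambda>z. \<phi> z $$ (a, b)) \<circ> cayley) holomorphic_on ball 0 1"
      using cayley_lower_half
      by (intro holomorphic_on_compose_gen[OF cayley_holomorphic that]) auto
    then show ?thesis by (auto simp: o_def intro!: holomorphic_intros)
  qed
  have lim: "((\<lambda>z. (?f \<phi>t a b z - ?f \<phi>h a b z) / z ^ k) \<longlongrightarrow> 0) (at 0)" if ab: "a < p" "b < p" for a b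
  proof (rule higher_deriv_eq_tendsto)
    fix i assume "i \<le> k"
    then have "taylor_alpha p \<phi>t i $$ (a, b) = taylor_alpha p \<phi>h i $$ (a, b)"
      using eq by simp
    then show "(deriv ^^ i) (?f \<phi>t a b) 0 = (deriv ^^ i) (?f \<phi>h a b) 0"
      using ab by (simp add: taylor_alpha_def cayley_def)
  qed (use hol ht hh ab in auto)
  have "(1 / z ^ k) \<cdot>\<^sub>m (weyl_frame p \<phi>t z - weyl_frame p \<phi>h z)
      = adj (Kmat p) * stack p (0\<^sub>m p p) (?D z)" for z
  proof -
    have "(1 / z ^ k) \<cdot>\<^sub>m (stack p (1\<^sub>m p) (?X \<phi>t z) - stack p (1\<^sub>m p) (?X \<phi>h z)) = stack p (0\<^sub>m p p) (?D z)"
      by (rule eq_matI) (auto simp: stack_def divide_simps)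
    from this[symmetric] show ?thesis
      unfolding weyl_frame_def by (simp add: mat_mult_minus_dim mat_mult_smult_dim)
  qed
  moreover have "mat_lim (2 * p) p (\<lambda>z. adj (Kmat p) * stack p (0\<^sub>m p p) (?D z))
      (adj (Kmat p) * stack p (0\<^sub>m p p) (0\<^sub>m p p)) (at 0)"
    using lim by (intro mat_lim_mult[OF mat_lim_const mat_lim_stack]) (auto intro!: tendsto_minus_cancel_left[THEN iffD1] simp: tendsto_minus_cancel_left)
  moreover have "stack p (0\<^sub>m p p) (0\<^sub>m p p) = 0\<^sub>m (2 * p) p"
    by (rule eq_matI) (auto simp: stack_def)
  ultimately show ?thesis by simp
qed

section \<open>Dependence on finitely many coefficients and the conclusion\<close>

lemma Wsol_cong: "(\<And>k. k < n \<Longrightarrow> C k = C' k) \<Longrightarrow> Wsol p C l n = Wsol p C' l n"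
  by (induction n) auto

text \<open>\<open>calW\<close> evaluates the solution at \<open>Suc L\<close>, which involves only
  the coefficients of index at most \<open>L\<close>. This permits changing the sequence beyond
  \<open>L\<close>.\<close>

lemma weyl_function_cong:
  assumes "\<And>k. k \<le> L \<Longrightarrow> C k = C' k"
  shows "weyl_function p C L \<phi> \<longleftrightarrow> weyl_function p C' L \<phi>"
proof -
  have "Wsol p C l (Suc L) = Wsol p C' l (Suc L)" for l
    using assms by (intro Wsol_cong) auto
  then have "calW p C L = calW p C' L"
    unfolding calW_def[abs_def] by (simp only:)
  then show ?thesis unfolding weyl_function_def by (simp only:)
qed

theorem theorem5p8:
  fixes p Nt Nh N :: nat
    and bt bh :: "nat \<Rightarrow> complex mat"
    and \<phi>t \<phi>h :: "complex \<Rightarrow> complex mat"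
  assumes "p \<ge> 1"
    and "\<forall>k\<le>Nt. bt k \<in> carrier_mat p (2 * p) \<and> bt k * Jmat p * adj (bt k) = 1\<^sub>m p"
    and "\<forall>k\<le>Nh. bh k \<in> carrier_mat p (2 * p) \<and> bh k * Jmat p * adj (bh k) = 1\<^sub>m p"
    and "weyl_function p (Cof p bt) Nt \<phi>t"
    and "weyl_function p (Cof p bh) Nh \<phi>h"
    and "N \<le> min Nt Nh"
    and "\<forall>k\<le>N. taylor_alpha p \<phi>t k = taylor_alpha p \<phi>h k"
  shows "\<forall>k\<le>N. Cof p bt k = Cof p bh k"
proof (intro allI impI)
  (* Extend both coefficient sequences to all indices, so that no range conditions are needed. *)
  define Bt where "Bt k = bt (min k Nt)" for k
  define Bh where "Bh k = bh (min k Nh)" for k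
  have Bt: "jnormal p (Bt k * Kmat p)" "Bt k \<in> carrier_mat p (2 * p)" for k
    using assms(2) by (auto simp: Bt_def intro!: jnormal_Kmat)
  have Bh: "jnormal p (Bh k * Kmat p)" "Bh k \<in> carrier_mat p (2 * p)" for k
    using assms(3) by (auto simp: Bh_def intro!: jnormal_Kmat)
  have Wt: "weyl_function p (Cof p Bt) Nt \<phi>t"
    using assms(4) weyl_function_cong[of Nt "Cof p bt" "Cof p Bt"] by (simp add: Cof_def Bt_def)
  have Wh: "weyl_function p (Cof p Bh) Nh \<phi>h"
    using assms(5) weyl_function_cong[of Nh "Cof p bh" "Cof p Bh"] by (simp add: Cof_def Bh_def)
  obtain Gt Gt0 Mt Mt0 Yt0 where t: "mat_lim (2 * p) p Gt Gt0 (at 0)" "jneg_frame p Gt0"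
      "mat_lim p p Mt Mt0 (at 0)" "mat_lim (2 * p) p (weyl_frame p \<phi>t) Yt0 (at 0)"
      "\<forall>\<^sub>F z in at 0. mprod (2 * p) (\<lambda>k. bp_fac p (Bt k * Kmat p) z) (Suc Nt) * Gt z = weyl_frame p \<phi>t z * Mt z"
    by (rule weyl_function_frame[where \<beta> = Bt, OF Bt Wt])
  obtain Gh Gh0 Mh Mh0 Yh0 where h: "mat_lim (2 * p) p Gh Gh0 (at 0)" "jneg_frame p Gh0"
      "mat_lim p p Mh Mh0 (at 0)" "mat_lim (2 * p) p (weyl_frame p \<phi>h) Yh0 (at 0)"
      "\<forall>\<^sub>F z in at 0. mprod (2 * p) (\<lambda>k. bp_fac p (Bh k * Kmat p) z) (Suc Nh) * Gh z = weyl_frame p \<phi>h z * Mh z"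
    by (rule weyl_function_frame[where \<beta> = Bh, OF Bh Wh])
  have D: "mat_lim (2 * p) p (\<lambda>z. (1 / z ^ k) \<cdot>\<^sub>m (weyl_frame p \<phi>t z - weyl_frame p \<phi>h z))
      (0\<^sub>m (2 * p) p) (at 0)" if "k \<le> N" for k
    using Wt Wh assms(7) that unfolding weyl_function_def by (intro weyl_frame_diff_tendsto) auto
  fix k assume k: "k \<le> N"
  have "jproj p (Bt k * Kmat p) = jproj p (Bh k * Kmat p)"
    by (rule jproj_determined[where Bt = "\<lambda>k. Bt k * Kmat p" and Bh = "\<lambda>k. Bh k * Kmat p",
        OF Bt(1) Bh(1) t(1,2) h(1,2) t(3) h(3) weyl_frame_carrier h(4) t(5) h(5) D])
      (use assms(6) k in auto)
  then have "Cof p Bt k = Cof p Bh k"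
    by (rule Cof_eqI[where \<beta> = Bt and \<beta>' = Bh, OF Bt(2) Bh(2)])
  then show "Cof p bt k = Cof p bh k"
    \<comment> \<open>For \<open>k \<le> N\<close> both minima equal \<open>k\<close>, so the
      extended sequences return the original matrices.\<close>
    using k assms(6) by (simp add: Cof_def Bt_def Bh_def)
qed

end
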